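(* Let $T\in\mathbb{B}(H)$ be a left invertible operator on a Hilbert space $H$. Then the sequence $\{\Delta_{t/n}^n(T)\}_n$ converges to the Aluthge flow $F^A_t(T)$ in the operator norm as $n\to\infty$, uniformly in $t$ on compact subsets of $[0,\infty)$.
   Context: $\mathbb{B}(H)$ is the algebra of bounded operators on $H$; $|X|=(X^*X)^{1/2}$; $[A,B]=AB-BA$. For $X\in\mathbb{B}(H)$ with polar decomposition $X=U|X|$ and $0<\lambda<1$, the $\lambda$-Aluthge transform is $\Delta_\lambda(X)=|X|^\lambda U|X|^{1-\lambda}$ (with $\Delta_0(X)=X$ for left invertible $X$); $\Delta_\lambda^n$ is its $n$-fold iterate. $\Delta_{t/n}$ is considered for $n>t$. An operator $X$ is left invertible iff $|X|$ is invertible, i.e. $\min\sigma(|X|)>0$. For left invertible $T$, $F^A_t(T):=X(t)$, where $X$ is the unique global solution on $[0,\infty)$ (derivative in operator norm, values in left invertible operators) of $\frac{dX(t)}{dt}=[\log|X(t)|,X(t)]$, $X(0)=T$. *)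

theory Defs
  imports "HOL-Analysis.Analysis" "HOL-Computational_Algebra.Polynomial"
begin

section \<open>Complex Hilbert spaces\<close>

text \<open>The inner product is linear in its first argument. Positive definiteness is part of
  \<open>cinner_self\<close>, and \<open>scaleR_scaleC\<close> ties the real structure used by the
  library (norm, \<open>\<Rightarrow>\<^sub>L\<close>, derivatives) to the complex one.\<close>

class complex_inner = real_normed_vector +
  fixes scaleC :: "complex \<Rightarrow> 'a \<Rightarrow> 'a"  (infixr "*\<^sub>C" 75)
    and cinner :: "'a \<Rightarrow> 'a \<Rightarrow> complex"
  assumes scaleC_add_right: "c *\<^sub>C (x + y) = c *\<^sub>C x + c *\<^sub>C y"
    and scaleC_add_left: "(c + d) *\<^sub>C x = c *\<^sub>C x + d *\<^sub>C x"
    and scaleC_scaleC: "c *\<^sub>C (d *\<^sub>C x) = (c * d) *\<^sub>C x"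
    and scaleR_scaleC: "r *\<^sub>R x = complex_of_real r *\<^sub>C x"
    and cinner_commute: "cinner x y = cnj (cinner y x)"
    and cinner_add_left: "cinner (x + y) z = cinner x z + cinner y z"
    and cinner_scaleC_left: "cinner (c *\<^sub>C x) y = c * cinner x y"
    and cinner_self: "cinner x x = complex_of_real ((norm x)\<^sup>2)"

class chilbert_space = complex_inner + complete_space

subclass (in chilbert_space) banach ..

section \<open>Bounded operators\<close>

text \<open>\<open>bounded_ops\<close> is the algebra of bounded complex-linear operators, inside the
  bounded real-linear ones; the norm of \<open>\<Rightarrow>\<^sub>L\<close> is the usual operator norm on it.\<close>

definition bounded_ops :: "('a::complex_inner \<Rightarrow>\<^sub>L 'a) set" where
  "bounded_ops = {A. \<forall>c x. blinfun_apply A (c *\<^sub>C x) = c *\<^sub>C blinfun_apply A x}"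

definition adj :: "('a::complex_inner \<Rightarrow>\<^sub>L 'a) \<Rightarrow> 'a \<Rightarrow>\<^sub>L 'a" where
  "adj A = (THE B. B \<in> bounded_ops \<and>
     (\<forall>x y. cinner (blinfun_apply A x) y = cinner x (blinfun_apply B y)))"

definition left_invertible :: "('a::complex_inner \<Rightarrow>\<^sub>L 'a) \<Rightarrow> bool" where
  "left_invertible A \<longleftrightarrow> A \<in> bounded_ops \<and> (\<exists>B\<in>bounded_ops. B o\<^sub>L A = id_blinfun)"

definition op_spectrum :: "('a::complex_inner \<Rightarrow>\<^sub>L 'a) \<Rightarrow> complex set" where
  "op_spectrum A = {c. \<not> (\<exists>B\<in>bounded_ops. \<forall>x.
     blinfun_apply B (blinfun_apply A x - c *\<^sub>C x) = x \<and>
     blinfun_apply A (blinfun_apply B x) - c *\<^sub>C blinfun_apply B x = x)}"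

section \<open>Continuous functional calculus\<close>

definition op_poly :: "real poly \<Rightarrow> ('a::complex_inner \<Rightarrow>\<^sub>L 'a) \<Rightarrow> 'a \<Rightarrow>\<^sub>L 'a" where
  "op_poly p A = (\<Sum>i\<le>degree p. coeff p i *\<^sub>R (((o\<^sub>L) A ^^ i) id_blinfun))"

text \<open>\<open>cfc f A\<close> is \<open>f(A)\<close> for self-adjoint \<open>A\<close>, whose spectrum is real, and for
  \<open>f\<close> continuous on the spectrum: the common limit of \<open>p\<^sub>n(A)\<close> over all sequences of
  polynomials \<open>p\<^sub>n\<close> that converge to \<open>f\<close> uniformly on the spectrum.\<close>

definition cfc :: "(real \<Rightarrow> real) \<Rightarrow> ('a::complex_inner \<Rightarrow>\<^sub>L 'a) \<Rightarrow> 'a \<Rightarrow>\<^sub>L 'a" where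
  "cfc f A = (THE B. \<forall>p. uniform_limit {x. complex_of_real x \<in> op_spectrum A}
       (\<lambda>n. poly (p n)) f sequentially
     \<longrightarrow> (\<lambda>n. op_poly (p n) A) \<longlonglongrightarrow> B)"

definition op_abs :: "('a::complex_inner \<Rightarrow>\<^sub>L 'a) \<Rightarrow> 'a \<Rightarrow>\<^sub>L 'a" where
  "op_abs A = cfc sqrt (adj A o\<^sub>L A)"

section \<open>Aluthge transform and Aluthge flow\<close>

definition partial_isometry :: "('a::complex_inner \<Rightarrow>\<^sub>L 'a) \<Rightarrow> bool" where
  "partial_isometry U \<longleftrightarrow> U \<in> bounded_ops \<and>
     (\<forall>x. (\<forall>y. blinfun_apply U y = 0 \<longrightarrow> cinner x y = 0) \<longrightarrow> norm (blinfun_apply U x) = norm x)"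

definition polar_part :: "('a::complex_inner \<Rightarrow>\<^sub>L 'a) \<Rightarrow> 'a \<Rightarrow>\<^sub>L 'a" where
  "polar_part A = (THE U. partial_isometry U \<and> A = U o\<^sub>L op_abs A \<and>
     (\<forall>x. blinfun_apply U x = 0 \<longleftrightarrow> blinfun_apply A x = 0))"

text \<open>Meaningful for \<open>0 < l < 1\<close>, and for \<open>l = 0\<close> when \<open>A\<close> is left invertible.\<close>

definition aluthge :: "real \<Rightarrow> ('a::complex_inner \<Rightarrow>\<^sub>L 'a) \<Rightarrow> 'a \<Rightarrow>\<^sub>L 'a" where
  "aluthge l A = (if l = 0 then A else
     cfc (\<lambda>x. x powr l) (op_abs A) o\<^sub>L polar_part A o\<^sub>L cfc (\<lambda>x. x powr (1 - l)) (op_abs A))"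

definition commutator :: "('a::real_normed_vector \<Rightarrow>\<^sub>L 'a) \<Rightarrow> ('a \<Rightarrow>\<^sub>L 'a) \<Rightarrow> 'a \<Rightarrow>\<^sub>L 'a" where
  "commutator A B = (A o\<^sub>L B) - (B o\<^sub>L A)"

definition aluthge_solution ::
    "('a::complex_inner \<Rightarrow>\<^sub>L 'a) \<Rightarrow> (real \<Rightarrow> 'a \<Rightarrow>\<^sub>L 'a) \<Rightarrow> bool" where
  "aluthge_solution T X \<longleftrightarrow> X 0 = T \<and>
     (\<forall>t\<ge>0. left_invertible (X t) \<and>
       (X has_vector_derivative commutator (cfc ln (op_abs (X t))) (X t)) (at t within {0..}))"

text \<open>A solution is only determined on \<open>[0,\<infinity>)\<close>, so the description picks its value at
  \<open>t\<close> rather than the function itself.\<close>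

definition aluthge_flow :: "real \<Rightarrow> ('a::complex_inner \<Rightarrow>\<^sub>L 'a) \<Rightarrow> 'a \<Rightarrow>\<^sub>L 'a" where
  "aluthge_flow t T = (THE Y. \<exists>X. aluthge_solution T X \<and> Y = X t)"

end

theory Submission
  imports Defs "HOL-Computational_Algebra.Fundamental_Theorem_Algebra"
begin

text \<open>
  Write \<open>|A|\<close> for the modulus and \<open>f(A) = [log |A|, A]\<close> for the vector field of the Aluthge flow.
  For left invertible \<open>A\<close> the modulus is invertible and the partial isometry of the polar
  decomposition is \<open>A |A|\<^sup>-\<^sup>1\<close>, so that the transform is a conjugation,
  \<open>\<Delta>\<^sub>h(A) = |A|\<^sup>h A |A|\<^sup>-\<^sup>h = A + h f(A) + O(h\<^sup>2)\<close>. Hence \<open>\<Delta>\<^sub>t\<^sub>/\<^sub>n\<close> iterated \<open>n\<close> times is a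
  consistent one-step approximation of the flow with step \<open>t / n\<close>, and its global error is \<open>O(1 / n)\<close>
  as soon as the constants are uniform along the iteration.

  Uniformity comes from an invariant set. If \<open>m \<parallel>x\<parallel> \<le> \<parallel>A x\<parallel> \<le> M \<parallel>x\<parallel>\<close> for all \<open>x\<close>, then the same holds
  for \<open>\<Delta>\<^sub>h(A)\<close> when \<open>0 \<le> h \<le> 1\<close> (\<open>aluthge_in\<close>): one loses at most the factors \<open>m\<^sup>h\<close> and \<open>m\<^sup>1\<^sup>-\<^sup>h\<close>
  from below and \<open>M\<^sup>h\<close> and \<open>M\<^sup>1\<^sup>-\<^sup>h\<close> from above. On this closed set \<open>f\<close> is bounded and Lipschitz
  (\<open>aluthge_field_lipschitz\<close>), because \<open>log |A|\<close> is half of \<open>log (A\<^sup>* A)\<close> and the power series of the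
  logarithm is Lipschitz on hermitian operators with spectrum in \<open>[m\<^sup>2, M\<^sup>2]\<close>, and the consistency error
  is uniform (\<open>aluthge_expansion\<close>).

  The set is not convex, so Picard iteration is not available on it. Existence of the flow is instead
  read off from the scheme itself: the iterates with step sizes \<open>2\<^sup>-\<^sup>j\<close> form a Cauchy sequence and stay
  in the set, and the limit satisfies the differential equation (\<open>ex_solution\<close>). Conversely the
  iterates converge to every solution that stays in such a set (\<open>scheme_converges_to_solution\<close>), and
  each solution does so on compact time intervals, by compactness of its trajectory. This gives
  uniqueness of the flow and the claimed uniform convergence at the same time.

  The functional calculus rests on one inequality: for hermitian \<open>A\<close> the norm of \<open>p(A)\<close> is at most
  the supremum of \<open>|p|\<close> on the real spectrum (\<open>norm_op_poly_le\<close>). It makes the limits that define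
  \<open>cfc\<close> exist, and it turns every scalar estimate on \<open>[m, M]\<close> into an operator estimate.
\<close>

section \<open>Real inner product, Riesz representation and adjoints\<close>

text \<open>The real part of the inner product is a bounded real bilinear form, so that the general theory
  of such forms applies. It loses nothing: the imaginary part is recovered by
  inserting the scalar \<open>\<i>\<close>, since the operators considered are complex-linear.\<close>
definition rin :: "'a::complex_inner \<Rightarrow> 'a \<Rightarrow> real" where
  "rin x y = Re (cinner x y)"

lemma rin_commute: "rin x y = rin y x"
  unfolding rin_def by (subst cinner_commute) simp

lemma rin_self: "rin x x = (norm x)\<^sup>2"
  by (simp add: rin_def cinner_self)

lemma rin_add_left: "rin (x + y) z = rin x z + rin y z"
  by (simp add: rin_def cinner_add_left)

lemma rin_add_right: "rin x (y + z) = rin x y + rin x z"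
  using rin_add_left[of y z x] by (simp add: rin_commute)

lemma rin_scaleR_left: "rin (r *\<^sub>R x) y = r * rin x y"
  by (simp add: rin_def scaleR_scaleC cinner_scaleC_left)

lemma rin_scaleR_right: "rin x (r *\<^sub>R y) = r * rin x y"
  using rin_scaleR_left[of r y x] by (simp add: rin_commute)

lemma rin_le_norm: "rin x y \<le> norm x * norm y"
proof -
  have "(norm (x + y))\<^sup>2 = (norm x)\<^sup>2 + 2 * rin x y + (norm y)\<^sup>2"
    using rin_commute[of x y] by (simp add: rin_self[symmetric] rin_add_left rin_add_right)
  moreover have "(norm (x + y))\<^sup>2 \<le> (norm x + norm y)\<^sup>2"
    by (intro power_mono norm_triangle_ineq) simp
  ultimately show ?thesis by (simp add: power2_sum)
qed

lemma bounded_bilinear_rin: "bounded_bilinear (rin :: 'a::complex_inner \<Rightarrow> 'a \<Rightarrow> real)"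
proof
  have "- rin a b \<le> norm a * norm b" for a b :: 'a
    using rin_le_norm[of "(-1) *\<^sub>R a" b] by (simp only: rin_scaleR_left) simp
  then have "norm (rin a b) \<le> norm a * norm b * 1" for a b :: 'a
    using rin_le_norm[of a b] by (smt (verit) real_norm_def mult.right_neutral)
  then show "\<exists>K. \<forall>a b :: 'a. norm (rin a b) \<le> norm a * norm b * K" by blast
qed (simp_all add: rin_add_left rin_add_right rin_scaleR_left rin_scaleR_right)

interpretation rin: bounded_bilinear "rin :: 'a::complex_inner \<Rightarrow> 'a \<Rightarrow> real"
  by (rule bounded_bilinear_rin)

lemma norm_add_sq: "(norm (x + y))\<^sup>2 = (norm x)\<^sup>2 + 2 * rin x y + (norm y)\<^sup>2" for x y :: "'a::complex_inner"
  using rin_commute[of x y] by (simp add: rin_self[symmetric] rin.add_left rin.add_right)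

lemma norm_diff_sq: "(norm (x - y))\<^sup>2 = (norm x)\<^sup>2 - 2 * rin x y + (norm y)\<^sup>2" for x y :: "'a::complex_inner"
  using rin_commute[of x y] by (simp add: rin_self[symmetric] rin.diff_left rin.diff_right)

lemma rin_scaleC: "rin (c *\<^sub>C x) y = rin x (cnj c *\<^sub>C y)"
proof -
  have "cinner x (cnj c *\<^sub>C y) = cnj (cnj c * cinner y x)"
    by (subst cinner_commute) (simp add: cinner_scaleC_left)
  also have "\<dots> = cinner (c *\<^sub>C x) y" by (simp add: cinner_scaleC_left cinner_commute[of y x])
  finally show ?thesis by (simp add: rin_def)
qed

lemma rin_ext: "(\<And>x. rin x y = rin x z) \<Longrightarrow> y = z"
  using rin_self[of "y - z"] by (simp add: rin.diff_right)

lemma cinner_eq_rin: "cinner x y = Complex (rin x y) (rin x (\<i> *\<^sub>C y))"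
proof -
  have "cinner x (\<i> *\<^sub>C y) = cnj (\<i> * cinner y x)"
    by (subst cinner_commute) (simp add: cinner_scaleC_left)
  then show ?thesis by (simp add: rin_def complex_eq_iff cinner_commute[of x y])
qed

lemma scaleC_scaleR_commute: "c *\<^sub>C (r *\<^sub>R x) = r *\<^sub>R (c *\<^sub>C x)"
  by (simp add: scaleR_scaleC scaleC_scaleC mult.commute)

lemma scaleC_diff_right: "c *\<^sub>C (x - y) = c *\<^sub>C x - c *\<^sub>C y"
  using scaleC_add_right[of c "x - y" y] by (simp add: eq_diff_eq)

lemma scaleC_zero_right: "c *\<^sub>C 0 = (0::'a::complex_inner)"
  using scaleC_diff_right[of c 0 0] by simp

lemma norm_scaleC: "norm (c *\<^sub>C x) = cmod c * norm x"
proof -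
  have "(norm (c *\<^sub>C x))\<^sup>2 = rin x ((cnj c * c) *\<^sub>C x)"
    by (simp add: rin_self[symmetric] rin_scaleC scaleC_scaleC)
  also have "cnj c * c = complex_of_real ((cmod c)\<^sup>2)"
    by (simp only: complex_norm_square mult.commute)
  finally have "(norm (c *\<^sub>C x))\<^sup>2 = (cmod c * norm x)\<^sup>2"
    by (simp only: scaleR_scaleC[symmetric] rin.scaleR_right rin_self) (simp add: power_mult_distrib)
  then show ?thesis by (simp add: power2_eq_iff_nonneg)
qed

text \<open>The representing vector minimises \<open>\<parallel>x\<parallel>\<^sup>2 - 2 \<phi>(x)\<close>. By the parallelogram law every minimising
  sequence is Cauchy, and the first variation at the minimum vanishes, which is the assertion.\<close>
lemma riesz_representation:
  fixes \<phi> :: "'a::chilbert_space \<Rightarrow> real"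
  assumes "bounded_linear \<phi>"
  shows "\<exists>z. \<forall>v. rin v z = \<phi> v"
proof -
  interpret \<phi>: bounded_linear \<phi> by fact
  obtain K where K: "\<And>x. norm (\<phi> x) \<le> norm x * K" using \<phi>.bounded by blast
  define q where "q x = (norm x)\<^sup>2 - 2 * \<phi> x" for x
  have lb: "- K\<^sup>2 \<le> q x" for x
  proof -
    have "0 \<le> (norm x - K)\<^sup>2" by simp
    then show ?thesis using K[of x] by (simp add: q_def power2_diff)
  qed
  define d where "d = (INF x. q x)"
  have bdd: "bdd_below (range q)" by (rule bdd_belowI2[of UNIV "- K\<^sup>2" q, OF lb])
  have dq: "d \<le> q x" for x unfolding d_def by (intro cINF_lower bdd) simp
  have "\<exists>x. q x < d + 1 / real (Suc n)" for n
  proof -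
    have "d < d + 1 / real (Suc n)" by simp
    then show ?thesis using cINF_less_iff[OF _ bdd, of "d + 1 / real (Suc n)"] unfolding d_def by blast
  qed
  then obtain X where X: "\<And>n. q (X n) < d + 1 / real (Suc n)" by metis
  have par: "(norm (x - y))\<^sup>2 = 2 * q x + 2 * q y - 4 * q ((1/2) *\<^sub>R (x + y))" for x y
  proof -
    have "(norm ((1/2) *\<^sub>R (x + y)))\<^sup>2 = (norm (x + y))\<^sup>2 / 4" by (simp add: power_mult_distrib power2_eq_square)
    moreover have "\<phi> ((1/2) *\<^sub>R (x + y)) = (\<phi> x + \<phi> y) / 2" by (simp add: \<phi>.scaleR \<phi>.add)
    ultimately show ?thesis by (simp add: q_def norm_add_sq norm_diff_sq)
  qed
  have "Cauchy X"
  proof (rule metric_CauchyI)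
    fix e :: real assume e: "0 < e"
    obtain N :: nat where N: "4 / e\<^sup>2 < real N" using reals_Archimedean2 by blast
    have "dist (X m) (X n) < e" if "N \<le> m" "N \<le> n" for m n
    proof -
      have N0: "0 < real N" using N e by (smt (verit) divide_pos_pos zero_less_power)
      have *: "1 / real (Suc k) \<le> 1 / real N" if "N \<le> k" for k
        using that N0 by (intro divide_left_mono) auto
      have "(norm (X m - X n))\<^sup>2 < 4 * (1 / real N)"
        using par[of "X m" "X n"] X[of m] X[of n] dq[of "(1/2) *\<^sub>R (X m + X n)"]
          *[OF that(1)] *[OF that(2)] by linarith
      also have "\<dots> < e\<^sup>2" using N N0 e by (simp add: field_simps)
      finally show ?thesis using e by (simp add: dist_norm power2_less_imp_less)
    qed
    then show "\<exists>M. \<forall>m\<ge>M. \<forall>n\<ge>M. dist (X m) (X n) < e" by blast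
  qed
  then obtain z where z: "X \<longlonglongrightarrow> z" using Cauchy_convergent convergent_def by blast
  have "(\<lambda>n. q (X n)) \<longlonglongrightarrow> q z" unfolding q_def by (intro tendsto_intros \<phi>.tendsto z)
  moreover have "(\<lambda>n. d + 1 / real (Suc n)) \<longlonglongrightarrow> d"
    using tendsto_add[OF tendsto_const LIMSEQ_Suc[OF lim_1_over_n[where 'a=real]], of d] by simp
  ultimately have qz: "q z \<le> d" by (rule LIMSEQ_le) (use X in \<open>auto intro: less_imp_le\<close>)
  have "rin v z = \<phi> v" for v
  proof -
    define g where "g = rin v z - \<phi> v"
    have ge: "0 \<le> t\<^sup>2 * (norm v)\<^sup>2 + 2 * t * g" for t
    proof -
      have "q z \<le> q (z + t *\<^sub>R v)" using qz dq[of "z + t *\<^sub>R v"] by simp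
      then show ?thesis
        by (simp add: q_def norm_add_sq \<phi>.add \<phi>.scaleR power_mult_distrib rin.scaleR_right g_def
            rin_commute[of z v] algebra_simps)
    qed
    \<comment> \<open>With step \<open>-s g\<close> the quadratic term is dominated by the linear one, which forces \<open>g = 0\<close>.\<close>
    define s where "s = 1 / (1 + (norm v)\<^sup>2)"
    have s: "0 < s" "s * (norm v)\<^sup>2 \<le> 1"
      by (auto simp: s_def field_simps add_pos_nonneg)
    have "(s * (norm v)\<^sup>2) * (s * g\<^sup>2) \<le> 1 * (s * g\<^sup>2)" using s by (intro mult_right_mono) auto
    moreover have "0 \<le> (s * (norm v)\<^sup>2) * (s * g\<^sup>2) - 2 * (s * g\<^sup>2)"
      using ge[of "- s * g"] by (simp add: power2_eq_square algebra_simps)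
    ultimately have "s * g\<^sup>2 \<le> 0" by linarith
    then have "g = 0" using s by (simp add: mult_le_0_iff)
    then show ?thesis by (simp add: g_def)
  qed
  then show ?thesis by blast
qed

lemma bounded_ops_apply: "A \<in> bounded_ops \<Longrightarrow> A (c *\<^sub>C x) = c *\<^sub>C A x"
  by (simp add: bounded_ops_def)

lemma cinner_adjoint_iff:
  assumes "A \<in> bounded_ops" "B \<in> bounded_ops"
  shows "(\<forall>x y. cinner (blinfun_apply A x) y = cinner x (blinfun_apply B y)) \<longleftrightarrow> (\<forall>x y. rin (A x) y = rin x (B y))"
proof (intro iffI allI)
  fix x y assume "\<forall>x y. rin (A x) y = rin x (B y)"
  then show "cinner (blinfun_apply A x) y = cinner x (blinfun_apply B y)"
    unfolding cinner_eq_rin bounded_ops_apply[OF assms(2), of \<i> y, symmetric] by simp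
qed (simp add: rin_def)

text \<open>Riesz representation of \<open>v \<mapsto> Re \<langle>A v, y\<rangle>\<close> gives the value of the adjoint at \<open>y\<close>.\<close>
lemma ex_adjoint:
  fixes A :: "'a::chilbert_space \<Rightarrow>\<^sub>L 'a"
  assumes A: "A \<in> bounded_ops"
  shows "\<exists>B\<in>bounded_ops. \<forall>x y. rin (A x) y = rin x (B y)"
proof -
  have "\<exists>z. \<forall>v. rin v z = rin (A v) y" for y
  proof (rule riesz_representation)
    show "bounded_linear (\<lambda>v. rin (A v) y)"
      by (intro bounded_linear_compose[OF rin.bounded_linear_left] blinfun.bounded_linear_right)
  qed
  then obtain b where b: "\<And>v y. rin v (b y) = rin (A v) y" by metis
  have "bounded_linear b"
  proof (rule bounded_linear_intro[where K="norm A"])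
    show "b (x + y) = b x + b y" for x y by (rule rin_ext) (simp add: b rin.add_right)
    show "b (r *\<^sub>R x) = r *\<^sub>R b x" for r x by (rule rin_ext) (simp add: b rin.scaleR_right)
    show "norm (b x) \<le> norm x * norm A" for x
    proof (cases "b x = 0")
      case False
      have "(norm (b x))\<^sup>2 = rin (A (b x)) x" by (simp add: rin_self[symmetric] b)
      also have "\<dots> \<le> norm (A (b x)) * norm x" by (rule rin_le_norm)
      also have "\<dots> \<le> norm A * norm (b x) * norm x" by (intro mult_right_mono norm_blinfun) simp
      finally show ?thesis using False by (simp add: power2_eq_square mult_ac)
    qed simp
  qed
  then have B: "Blinfun b y = b y" for y by (simp add: bounded_linear_Blinfun_apply)
  have "b (c *\<^sub>C y) = c *\<^sub>C b y" for c y
    by (rule rin_ext) (simp add: b rin_scaleC[of "cnj c", simplified, symmetric] bounded_ops_apply[OF A])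
  then have "Blinfun b \<in> bounded_ops" by (simp add: bounded_ops_def B)
  then show ?thesis using b B by (metis)
qed

lemma adj_eqI:
  fixes A :: "'a::complex_inner \<Rightarrow>\<^sub>L 'a"
  assumes "A \<in> bounded_ops" "B \<in> bounded_ops" "\<And>x y. rin (A x) y = rin x (B y)"
  shows "adj A = B"
  unfolding adj_def
proof (rule the_equality)
  fix B' assume B': "B' \<in> bounded_ops \<and> (\<forall>x y. cinner (blinfun_apply A x) y = cinner x (blinfun_apply B' y))"
  then have "rin (A x) y = rin x (B' y)" for x y using cinner_adjoint_iff[OF assms(1), of B'] by blast
  then have "rin x (B' y) = rin x (B y)" for x y using assms(3) by simp
  then have "B' y = B y" for y by (rule rin_ext)
  then show "B' = B" by (rule blinfun_eqI)
next
  show "B \<in> bounded_ops \<and> (\<forall>x y. cinner (blinfun_apply A x) y = cinner x (blinfun_apply B y))"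
  proof
    have "\<forall>x y. rin (A x) y = rin x (B y)" using assms(3) by blast
    then show "\<forall>x y. cinner (blinfun_apply A x) y = cinner x (blinfun_apply B y)"
      unfolding cinner_adjoint_iff[OF assms(1,2)] .
  qed (rule assms(2))
qed

lemma adj_works:
  fixes A :: "'a::chilbert_space \<Rightarrow>\<^sub>L 'a"
  assumes "A \<in> bounded_ops"
  shows "adj A \<in> bounded_ops" "rin (A x) y = rin x (adj A y)"
proof -
  obtain B where B: "B \<in> bounded_ops" "\<And>x y. rin (A x) y = rin x (B y)"
    using ex_adjoint[OF assms] by blast
  then have "adj A = B" by (intro adj_eqI assms)
  then show "adj A \<in> bounded_ops" "rin (A x) y = rin x (adj A y)" using B by simp_all
qed

lemma norm_adj_le:
  fixes A :: "'a::chilbert_space \<Rightarrow>\<^sub>L 'a"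
  assumes A: "A \<in> bounded_ops"
  shows "norm (adj A) \<le> norm A"
proof (rule norm_blinfun_bound)
  fix x show "norm (adj A x) \<le> norm A * norm x"
  proof (cases "adj A x = 0")
    case False
    have "(norm (adj A x))\<^sup>2 = rin (A (adj A x)) x" by (simp add: rin_self[symmetric] adj_works[OF A])
    also have "\<dots> \<le> norm (A (adj A x)) * norm x" by (rule rin_le_norm)
    also have "\<dots> \<le> norm A * norm (adj A x) * norm x" by (intro mult_right_mono norm_blinfun) simp
    finally show ?thesis using False by (simp add: power2_eq_square mult_ac)
  qed simp
qed simp

lemma bounded_ops_intros:
  "id_blinfun \<in> bounded_ops" "0 \<in> bounded_ops"
  "A \<in> bounded_ops \<Longrightarrow> B \<in> bounded_ops \<Longrightarrow> A + B \<in> bounded_ops"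
  "A \<in> bounded_ops \<Longrightarrow> B \<in> bounded_ops \<Longrightarrow> A - B \<in> bounded_ops"
  "A \<in> bounded_ops \<Longrightarrow> B \<in> bounded_ops \<Longrightarrow> A o\<^sub>L B \<in> bounded_ops"
  "A \<in> bounded_ops \<Longrightarrow> r *\<^sub>R A \<in> bounded_ops"
  for A B :: "'a::complex_inner \<Rightarrow>\<^sub>L 'a"
  by (auto simp: bounded_ops_def blinfun.bilinear_simps scaleC_zero_right scaleC_add_right
      scaleC_diff_right scaleC_scaleR_commute)

lemma adj_diff:
  fixes A B :: "'a::chilbert_space \<Rightarrow>\<^sub>L 'a"
  assumes "A \<in> bounded_ops" "B \<in> bounded_ops"
  shows "adj (A - B) = adj A - adj B"
  by (rule adj_eqI)
    (simp_all add: assms adj_works(1) adj_works(2)[OF assms(1)] adj_works(2)[OF assms(2)]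
      bounded_ops_intros blinfun.bilinear_simps rin.diff_left rin.diff_right)

lemma tendsto_blinfun_apply: "(A \<longlongrightarrow> a) F \<Longrightarrow> ((\<lambda>n. blinfun_apply (A n) x) \<longlongrightarrow> blinfun_apply a x) F"
  by (intro bounded_linear.tendsto[OF blinfun.bounded_linear_left])

lemma bounded_linear_scaleC: "bounded_linear ((*\<^sub>C) c :: 'a::complex_inner \<Rightarrow> 'a)"
  by (rule bounded_linear_intro[where K="cmod c"])
    (auto simp: scaleC_add_right scaleC_scaleR_commute norm_scaleC mult.commute)

lemma closed_bounded_ops: "closed (bounded_ops :: ('a::complex_inner \<Rightarrow>\<^sub>L 'a) set)"
  unfolding closed_sequential_limits
proof (intro allI impI, elim conjE)
  fix X and A :: "'a \<Rightarrow>\<^sub>L 'a" assume X: "\<forall>n. X n \<in> bounded_ops" and lim: "X \<longlonglongrightarrow> A"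
  have "A (c *\<^sub>C x) = c *\<^sub>C A x" for c x
  proof (rule LIMSEQ_unique)
    show "(\<lambda>n. X n (c *\<^sub>C x)) \<longlonglongrightarrow> A (c *\<^sub>C x)" by (rule tendsto_blinfun_apply[OF lim])
    have "(\<lambda>n. c *\<^sub>C X n x) \<longlonglongrightarrow> c *\<^sub>C A x"
      by (rule bounded_linear.tendsto[OF bounded_linear_scaleC tendsto_blinfun_apply[OF lim]])
    then show "(\<lambda>n. X n (c *\<^sub>C x)) \<longlonglongrightarrow> c *\<^sub>C A x" using X by (simp add: bounded_ops_apply)
  qed
  then show "A \<in> bounded_ops" by (simp add: bounded_ops_def)
qed

section \<open>Hermitian operators and invertibility\<close>

definition herm :: "('a::complex_inner \<Rightarrow>\<^sub>L 'a) \<Rightarrow> bool" where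
  "herm A \<longleftrightarrow> A \<in> bounded_ops \<and> (\<forall>x y. rin (A x) y = rin x (A y))"

lemma hermD: "herm A \<Longrightarrow> A \<in> bounded_ops" "herm A \<Longrightarrow> rin (A x) y = rin x (A y)"
  by (auto simp: herm_def)

lemma herm_intros:
  "herm id_blinfun"
  "herm A \<Longrightarrow> herm B \<Longrightarrow> herm (A + B)"
  "herm A \<Longrightarrow> herm B \<Longrightarrow> herm (A - B)"
  "herm A \<Longrightarrow> herm (r *\<^sub>R A)"
  for A B :: "'a::complex_inner \<Rightarrow>\<^sub>L 'a"
  by (auto simp: herm_def bounded_ops_intros blinfun.bilinear_simps rin.add_left rin.add_right
      rin.diff_left rin.diff_right rin.scaleR_left rin.scaleR_right)

lemma herm_compose: "herm A \<Longrightarrow> herm B \<Longrightarrow> A o\<^sub>L B = B o\<^sub>L A \<Longrightarrow> herm (A o\<^sub>L B)"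
  by (metis herm_def bounded_ops_intros(5) blinfun_apply_blinfun_compose)

lemma herm_adj_compose:
  fixes A :: "'a::chilbert_space \<Rightarrow>\<^sub>L 'a"
  assumes "A \<in> bounded_ops" shows "herm (adj A o\<^sub>L A)"
proof -
  have "rin (adj A (A x)) y = rin (A x) (A y)" for x y
    using adj_works(2)[OF assms, of y "A x"] by (simp add: rin_commute)
  then show ?thesis
    using assms adj_works[OF assms] by (simp add: herm_def bounded_ops_intros)
qed

lemma herm_limit: "(\<And>n. herm (X n)) \<Longrightarrow> X \<longlonglongrightarrow> A \<Longrightarrow> herm A"
  unfolding herm_def
proof (intro conjI allI)
  assume X: "\<And>n. X n \<in> bounded_ops \<and> (\<forall>x y. rin (X n x) y = rin x (X n y))" and lim: "X \<longlonglongrightarrow> A"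
  show "A \<in> bounded_ops" using closed_sequentially[OF closed_bounded_ops _ lim] X by blast
  fix x y
  show "rin (A x) y = rin x (A y)"
  proof (rule LIMSEQ_unique)
    show "(\<lambda>n. rin (X n x) y) \<longlonglongrightarrow> rin (A x) y" by (intro rin.tendsto tendsto_blinfun_apply lim tendsto_const)
    have "(\<lambda>n. rin x (X n y)) \<longlonglongrightarrow> rin x (A y)" by (intro rin.tendsto tendsto_blinfun_apply lim tendsto_const)
    then show "(\<lambda>n. rin (X n x) y) \<longlonglongrightarrow> rin x (A y)" using X by simp
  qed
qed

definition invertible_op :: "('a::complex_inner \<Rightarrow>\<^sub>L 'a) \<Rightarrow> bool" where
  "invertible_op A \<longleftrightarrow> (\<exists>B\<in>bounded_ops. B o\<^sub>L A = id_blinfun \<and> A o\<^sub>L B = id_blinfun)"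

lemma blinfun_compose_simps:
  "(A + B) o\<^sub>L C = (A o\<^sub>L C) + (B o\<^sub>L C)" "A o\<^sub>L (B + C) = (A o\<^sub>L B) + (A o\<^sub>L C)"
  "(A - B) o\<^sub>L C = (A o\<^sub>L C) - (B o\<^sub>L C)" "A o\<^sub>L (B - C) = (A o\<^sub>L B) - (A o\<^sub>L C)"
  "(r *\<^sub>R A) o\<^sub>L C = r *\<^sub>R (A o\<^sub>L C)" "A o\<^sub>L (r *\<^sub>R C) = r *\<^sub>R (A o\<^sub>L C)"
  "id_blinfun o\<^sub>L A = A" "A o\<^sub>L id_blinfun = A" "(A o\<^sub>L B) o\<^sub>L C = A o\<^sub>L (B o\<^sub>L C)"
  "0 o\<^sub>L A = 0" "A o\<^sub>L 0 = 0"
  for A B C :: "'a::real_normed_vector \<Rightarrow>\<^sub>L 'a"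
  by (auto intro!: blinfun_eqI simp: blinfun.bilinear_simps)

lemma invertible_opI:
  assumes "B \<in> bounded_ops" "B o\<^sub>L A = id_blinfun" "A o\<^sub>L B' = id_blinfun"
  shows "invertible_op A"
proof -
  have "B = B o\<^sub>L (A o\<^sub>L B')" by (simp add: assms blinfun_compose_simps)
  also have "\<dots> = (B o\<^sub>L A) o\<^sub>L B'" by (simp add: blinfun_compose_simps)
  also have "\<dots> = B'" unfolding assms by (simp add: blinfun_compose_simps)
  finally have "B = B'" .
  then show ?thesis using assms by (auto simp: invertible_op_def)
qed

lemma invertible_op_compose:
  assumes "invertible_op A" "invertible_op B" shows "invertible_op (A o\<^sub>L B)"
proof -
  obtain A' B' where *: "A' \<in> bounded_ops" "A' o\<^sub>L A = id_blinfun" "A o\<^sub>L A' = id_blinfun"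
    "B' \<in> bounded_ops" "B' o\<^sub>L B = id_blinfun" "B o\<^sub>L B' = id_blinfun"
    using assms by (auto simp: invertible_op_def)
  have "(B' o\<^sub>L A') o\<^sub>L (A o\<^sub>L B) = B' o\<^sub>L (A' o\<^sub>L A) o\<^sub>L B" "(A o\<^sub>L B) o\<^sub>L (B' o\<^sub>L A') = A o\<^sub>L (B o\<^sub>L B') o\<^sub>L A'"
    by (simp_all only: blinfun_compose_simps(9))
  then show ?thesis unfolding invertible_op_def
    by (intro bexI[of _ "B' o\<^sub>L A'"]) (use * in \<open>auto simp: bounded_ops_intros blinfun_compose_simps\<close>)
qed

lemma invertible_op_scaleR:
  assumes "invertible_op A" "r \<noteq> 0" shows "invertible_op (r *\<^sub>R A)"
proof -
  obtain B where "B \<in> bounded_ops" "B o\<^sub>L A = id_blinfun" "A o\<^sub>L B = id_blinfun"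
    using assms by (auto simp: invertible_op_def)
  then show ?thesis unfolding invertible_op_def using assms(2)
    by (intro bexI[of _ "inverse r *\<^sub>R B"]) (auto simp: blinfun_compose_simps bounded_ops_intros)
qed

text \<open>A Lax--Milgram argument: \<open>A x = y\<close> is the fixed point equation of \<open>x \<mapsto> x - \<epsilon> (A x - y)\<close>. Coercivity
  makes this map a contraction for small \<open>\<epsilon>\<close>, with squared factor \<open>1 - 2 \<epsilon> c + \<epsilon>\<^sup>2 K\<^sup>2\<close> if \<open>K\<close> bounds
  the norm of \<open>A\<close>; the choice \<open>\<epsilon> = c / K\<^sup>2\<close> minimises it.\<close>
lemma invertible_op_coercive:
  fixes A :: "'a::chilbert_space \<Rightarrow>\<^sub>L 'a"
  assumes A: "A \<in> bounded_ops" and c: "0 < c" and co: "\<And>x. c * (norm x)\<^sup>2 \<le> rin (A x) x"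
  shows "invertible_op A"
proof -
  define K where "K = norm A + c"
  have K: "0 < K" "c \<le> K" "norm A \<le> K" using c by (auto simp: K_def add_nonneg_pos)
  define \<epsilon> where "\<epsilon> = c / K\<^sup>2"
  have \<epsilon>: "0 < \<epsilon>" using c K by (simp add: \<epsilon>_def)
  define q where "q = sqrt (1 - (c / K)\<^sup>2)"
  have cK: "0 < (c/K)\<^sup>2" "(c/K)\<^sup>2 \<le> 1" using c K by (auto simp: power_le_one)
  have q: "0 \<le> q" "q < 1" using cK by (auto simp: q_def)
  have contr: "norm (d - \<epsilon> *\<^sub>R A d) \<le> q * norm d" for d
  proof -
    have "(norm (A d))\<^sup>2 \<le> (K * norm d)\<^sup>2"
      using norm_blinfun[of A d] mult_right_mono[OF K(3), of "norm d"] by (intro power_mono) auto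
    then have "\<epsilon>\<^sup>2 * (norm (A d))\<^sup>2 \<le> \<epsilon>\<^sup>2 * (K * norm d)\<^sup>2" by (intro mult_left_mono) auto
    moreover have "2 * \<epsilon> * (c * (norm d)\<^sup>2) \<le> 2 * \<epsilon> * rin (A d) d"
      using co[of d] \<epsilon> by (intro mult_left_mono) auto
    moreover have "(norm (d - \<epsilon> *\<^sub>R A d))\<^sup>2 = (norm d)\<^sup>2 - 2 * \<epsilon> * rin (A d) d + \<epsilon>\<^sup>2 * (norm (A d))\<^sup>2"
      by (simp add: norm_diff_sq rin.scaleR_right rin_commute[of d] power_mult_distrib)
    ultimately have "(norm (d - \<epsilon> *\<^sub>R A d))\<^sup>2 \<le> (norm d)\<^sup>2 - 2 * \<epsilon> * (c * (norm d)\<^sup>2) + \<epsilon>\<^sup>2 * (K * norm d)\<^sup>2" by linarith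
    also have "\<dots> = (1 - (c/K)\<^sup>2) * (norm d)\<^sup>2"
      using K by (simp add: \<epsilon>_def field_simps power2_eq_square)
    also have "1 - (c/K)\<^sup>2 = q\<^sup>2" unfolding q_def by (subst real_sqrt_pow2) (use cK(2) in linarith, rule refl)
    also have "q\<^sup>2 * (norm d)\<^sup>2 = (q * norm d)\<^sup>2" by (simp only: power_mult_distrib)
    finally show ?thesis by (rule power2_le_imp_le) (use q in simp)
  qed
  have "\<exists>!x. x - \<epsilon> *\<^sub>R (A x - y) = x" for y
  proof (rule banach_fix_type[OF q], intro allI)
    fix u v
    have "u - \<epsilon> *\<^sub>R (A u - y) - (v - \<epsilon> *\<^sub>R (A v - y)) = (u - v) - \<epsilon> *\<^sub>R A (u - v)"
      by (simp add: blinfun.diff_right algebra_simps)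
    then show "dist (u - \<epsilon> *\<^sub>R (A u - y)) (v - \<epsilon> *\<^sub>R (A v - y)) \<le> q * dist u v"
      using contr[of "u - v"] by (simp only: dist_norm)
  qed
  then have ex1: "\<exists>!x. A x = y" for y using \<epsilon> by simp
  then obtain b where b: "\<And>y. A (b y) = y" by metis
  have inj: "A u = A v \<Longrightarrow> u = v" for u v using ex1 by metis
  have "bounded_linear b"
  proof (rule bounded_linear_intro[where K="1/c"])
    show "b (x + y) = b x + b y" for x y by (rule inj) (simp add: b blinfun.add_right)
    show "b (r *\<^sub>R x) = r *\<^sub>R b x" for r x by (rule inj) (simp add: b blinfun.scaleR_right)
    show "norm (b x) \<le> norm x * (1/c)" for x
    proof (cases "b x = 0")
      case False
      have "c * (norm (b x))\<^sup>2 \<le> norm x * norm (b x)"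
        using co[of "b x"] rin_le_norm[of x "b x"] by (simp add: b)
      then show ?thesis using False c by (simp add: power2_eq_square field_simps)
    qed (use c in auto)
  qed
  then have B: "Blinfun b y = b y" for y by (simp add: bounded_linear_Blinfun_apply)
  have "b (s *\<^sub>C y) = s *\<^sub>C b y" for s y by (rule inj) (simp add: b bounded_ops_apply[OF A])
  then have "Blinfun b \<in> bounded_ops" by (simp add: bounded_ops_def B)
  moreover have "b (A x) = x" for x by (rule inj) (simp add: b)
  ultimately show ?thesis unfolding invertible_op_def
    by (intro bexI[of _ "Blinfun b"]) (auto intro!: blinfun_eqI simp: B b)
qed

abbreviation rspec :: "('a::complex_inner \<Rightarrow>\<^sub>L 'a) \<Rightarrow> real set" where
  "rspec A \<equiv> {x. complex_of_real x \<in> op_spectrum A}"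

lemma rspec_iff:
  fixes A :: "'a::complex_inner \<Rightarrow>\<^sub>L 'a"
  shows "complex_of_real x \<in> op_spectrum A \<longleftrightarrow> \<not> invertible_op (A - x *\<^sub>R id_blinfun)"
proof -
  have "(\<forall>v. B (A v - complex_of_real x *\<^sub>C v) = v \<and> A (B v) - complex_of_real x *\<^sub>C B v = v)
    \<longleftrightarrow> B o\<^sub>L (A - x *\<^sub>R id_blinfun) = id_blinfun \<and> (A - x *\<^sub>R id_blinfun) o\<^sub>L B = id_blinfun"
    for B :: "'a \<Rightarrow>\<^sub>L 'a"
    by (simp add: blinfun_apply_inject[symmetric] fun_eq_iff scaleR_scaleC[symmetric]
        blinfun.bilinear_simps all_conj_distrib)
  then show ?thesis by (simp only: op_spectrum_def invertible_op_def mem_Collect_eq)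
qed

section \<open>Norm and spectrum of polynomials in a hermitian operator\<close>

text \<open>In a nontrivial space the square of the norm \<open>r\<close> of a hermitian \<open>B\<close> lies in the spectrum of \<open>B\<^sup>2\<close>:
  \<open>\<parallel>(B\<^sup>2 - r\<^sup>2) v\<parallel>\<^sup>2 \<le> r\<^sup>2 (r\<^sup>2 \<parallel>v\<parallel>\<^sup>2 - \<parallel>B v\<parallel>\<^sup>2)\<close>, so vectors on which \<open>B\<close> almost attains its norm are
  approximate eigenvectors. An inverse of \<open>B\<^sup>2 - r\<^sup>2\<close> would bound \<open>\<parallel>B v\<parallel>\<close> by \<open>sqrt s \<parallel>v\<parallel>\<close> with
  \<open>sqrt s < r\<close>.\<close>
lemma invertible_norm_square_imp_trivial:
  fixes B :: "'a::chilbert_space \<Rightarrow>\<^sub>L 'a"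
  assumes B: "herm B" and inv: "invertible_op ((B o\<^sub>L B) - (norm B)\<^sup>2 *\<^sub>R id_blinfun)"
  shows "x = (0::'a)"
proof (rule ccontr)
  assume x0: "x \<noteq> 0"
  let ?r = "norm B" and ?D = "(B o\<^sub>L B) - (norm B)\<^sup>2 *\<^sub>R id_blinfun"
  obtain C where C: "C o\<^sub>L ?D = id_blinfun" using inv by (auto simp: invertible_op_def)
  define K where "K = norm C + 1"
  have K: "0 < K" by (simp add: K_def add_nonneg_pos)
  have est: "K\<^sup>2 * ?r\<^sup>2 * (norm (B v))\<^sup>2 \<le> (K\<^sup>2 * (?r\<^sup>2)\<^sup>2 - 1) * (norm v)\<^sup>2" for v
  proof -
    have "v = C (?D v)" using arg_cong[OF C, of "\<lambda>F. blinfun_apply F v"] by simp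
    then have "norm v \<le> norm C * norm (?D v)" by (metis norm_blinfun)
    also have "\<dots> \<le> K * norm (?D v)" by (intro mult_right_mono) (auto simp: K_def)
    finally have "(norm v)\<^sup>2 \<le> (K * norm (?D v))\<^sup>2" by (intro power_mono) auto
    then have 1: "(norm v)\<^sup>2 \<le> K\<^sup>2 * (norm (?D v))\<^sup>2" by (simp only: power_mult_distrib)
    have "(norm (?D v))\<^sup>2 = (norm (B (B v)))\<^sup>2 - 2 * ?r\<^sup>2 * (norm (B v))\<^sup>2 + (?r\<^sup>2)\<^sup>2 * (norm v)\<^sup>2"
      using hermD(2)[OF B, of "B v" v]
      by (simp add: blinfun.bilinear_simps norm_diff_sq rin.scaleR_right rin_self power_mult_distrib)
    moreover have "(norm (B (B v)))\<^sup>2 \<le> (?r * norm (B v))\<^sup>2" by (intro power_mono norm_blinfun) simp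
    ultimately have "(norm (?D v))\<^sup>2 \<le> (?r\<^sup>2)\<^sup>2 * (norm v)\<^sup>2 - ?r\<^sup>2 * (norm (B v))\<^sup>2"
      by (simp add: power_mult_distrib)
    then have "K\<^sup>2 * (norm (?D v))\<^sup>2 \<le> K\<^sup>2 * ((?r\<^sup>2)\<^sup>2 * (norm v)\<^sup>2 - ?r\<^sup>2 * (norm (B v))\<^sup>2)"
      by (rule mult_left_mono) simp
    with 1 show ?thesis by (simp add: algebra_simps)
  qed
  have pos: "0 \<le> K\<^sup>2 * (?r\<^sup>2)\<^sup>2 - 1"
  proof -
    have "0 \<le> (K\<^sup>2 * (?r\<^sup>2)\<^sup>2 - 1) * (norm x)\<^sup>2" using est[of x] by (rule order_trans[rotated]) simp
    then show ?thesis using x0 by (simp add: zero_le_mult_iff)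
  qed
  have r: "0 < ?r"
  proof (rule ccontr)
    assume "\<not> 0 < ?r" then have "?r = 0" using norm_ge_zero[of B] by linarith
    then show False using pos by simp
  qed
  have c: "0 < K\<^sup>2 * ?r\<^sup>2" using K r by simp
  define s where "s = (K\<^sup>2 * (?r\<^sup>2)\<^sup>2 - 1) / (K\<^sup>2 * ?r\<^sup>2)"
  have s0: "0 \<le> s" using pos c by (simp add: s_def)
  have "s < ?r\<^sup>2" using c by (simp add: s_def pos_divide_less_eq power2_eq_square)
  then have "sqrt s < ?r" using r s0 by (metis real_sqrt_less_iff real_sqrt_unique less_imp_le)
  moreover have "norm B \<le> sqrt s"
  proof (rule norm_blinfun_bound)
    fix v
    have "(norm (B v))\<^sup>2 \<le> s * (norm v)\<^sup>2"
      using est[of v] c by (simp add: s_def pos_le_divide_eq mult.commute)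
    also have "\<dots> = (sqrt s * norm v)\<^sup>2" using s0 by (simp add: power_mult_distrib)
    finally show "norm (B v) \<le> sqrt s * norm v" by (rule power2_le_imp_le) (use s0 in simp)
  qed (use s0 in simp)
  ultimately show False by simp
qed

lemma op_poly_extend:
  assumes "degree p \<le> n"
  shows "op_poly p A = (\<Sum>i\<le>n. coeff p i *\<^sub>R (((o\<^sub>L) A ^^ i) id_blinfun))"
  unfolding op_poly_def
  by (rule sum.mono_neutral_left) (use assms in \<open>auto simp: coeff_eq_0\<close>)

lemma op_poly_0 [simp]: "op_poly 0 A = 0"
  by (simp add: op_poly_def)

lemma op_poly_pCons: "op_poly (pCons a p) A = a *\<^sub>R id_blinfun + (A o\<^sub>L op_poly p A)"
proof -
  have "op_poly (pCons a p) A =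
      (\<Sum>i\<le>Suc (degree p). coeff (pCons a p) i *\<^sub>R (((o\<^sub>L) A ^^ i) id_blinfun))"
    by (rule op_poly_extend) (rule degree_pCons_le)
  also have "\<dots> = a *\<^sub>R id_blinfun + (\<Sum>i\<le>degree p. A o\<^sub>L (coeff p i *\<^sub>R (((o\<^sub>L) A ^^ i) id_blinfun)))"
    by (simp add: sum.atMost_Suc_shift blinfun_compose_simps del: sum.atMost_Suc)
  also have "(\<Sum>i\<le>degree p. A o\<^sub>L (coeff p i *\<^sub>R (((o\<^sub>L) A ^^ i) id_blinfun))) = A o\<^sub>L op_poly p A"
    unfolding op_poly_def by (rule bounded_bilinear.sum_right[OF bounded_bilinear_blinfun_compose, symmetric])
  finally show ?thesis .
qed

lemma op_poly_add: "op_poly (p + q) A = op_poly p A + op_poly q A"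
  by (induction p q rule: poly_induct2) (simp_all add: op_poly_pCons blinfun_compose_simps algebra_simps)

lemma op_poly_smult: "op_poly (smult c p) A = c *\<^sub>R op_poly p A"
  by (induction p) (simp_all add: op_poly_pCons blinfun_compose_simps algebra_simps)

lemma op_poly_diff: "op_poly (p - q) A = op_poly p A - op_poly q A"
  using op_poly_add[of p "smult (-1) q" A] by (simp only: op_poly_smult) simp

lemma op_poly_mult: "op_poly (p * q) A = op_poly p A o\<^sub>L op_poly q A"
  by (induction p) (simp_all add: op_poly_pCons op_poly_add op_poly_smult blinfun_compose_simps)

lemma op_poly_const: "op_poly [:c:] A = c *\<^sub>R id_blinfun"
  by (simp add: op_poly_pCons blinfun_compose_simps)

lemma op_poly_X: "op_poly [:0, 1:] A = A"
  by (simp add: op_poly_pCons blinfun_compose_simps)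

lemma herm_op_poly:
  assumes "herm A" shows "herm (op_poly p A)"
proof (induction p)
  case 0 then show ?case using herm_intros(4)[OF herm_intros(1), of 0] by simp
next
  case (pCons a p)
  have "A o\<^sub>L op_poly p A = op_poly p A o\<^sub>L A"
    using op_poly_mult[of "[:0,1:]" p A] op_poly_mult[of p "[:0,1:]" A] by (simp only: op_poly_X mult.commute)
  then show ?case unfolding op_poly_pCons by (intro herm_intros herm_compose assms pCons)
qed

lemma poly_of_real_hom:
  fixes z :: complex
  defines "E \<equiv> \<lambda>p. poly (map_poly complex_of_real p) z"
  shows "E (pCons a p) = of_real a + z * E p" "E (p + q) = E p + E q" "E (p * q) = E p * E q"
proof -
  have E0: "E 0 = 0" by (simp add: E_def)
  show EC: "E (pCons a p) = of_real a + z * E p" for a p by (simp add: E_def map_poly_pCons)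
  show EA: "E (p + q) = E p + E q" for p q
    by (induction p q rule: poly_induct2) (simp_all add: EC E0 algebra_simps)
  have ES: "E (smult c p) = of_real c * E p" for c p
    by (induction p) (simp_all add: EC E0 algebra_simps)
  show "E (p * q) = E p * E q"
    by (induction p) (simp_all add: EC EA ES E0 algebra_simps)
qed

text \<open>Nonreal roots come in conjugate pairs, and such a pair contributes the real factor
  \<open>(x - a)\<^sup>2 + b\<^sup>2\<close>. It is obtained by division with remainder: the remainder is linear and
  vanishes at a nonreal point.\<close>
lemma real_poly_factor:
  fixes q :: "real poly"
  assumes "degree q \<noteq> 0"
  obtains (linear) a s where "q = [:-a, 1:] * s"
  | (quadratic) a b s where "b \<noteq> 0" "q = [:a\<^sup>2 + b\<^sup>2, -2 * a, 1:] * s"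
proof -
  have "degree (map_poly complex_of_real q) = degree q" by (rule degree_map_poly) simp
  then have "\<not> constant (poly (map_poly complex_of_real q))"
    using assms by (simp add: constant_degree)
  then obtain z where z: "poly (map_poly complex_of_real q) z = 0"
    using fundamental_theorem_of_algebra by blast
  show ?thesis
  proof (cases "Im z = 0")
    case True
    then have "z = of_real (Re z)" by (simp add: complex_eq_iff)
    moreover have "poly (map_poly complex_of_real p) (of_real x) = of_real (poly p x)" for p x
      by (induction p) (simp_all add: map_poly_pCons)
    ultimately have "poly (map_poly complex_of_real q) z = of_real (poly q (Re z))" by metis
    with z have "poly q (Re z) = 0" by simp
    then have "[:- Re z, 1:] dvd q" by (simp add: poly_eq_0_iff_dvd)
    then show ?thesis using linear by (auto elim: dvdE)
  next
    case False
    let ?d = "[:(Re z)\<^sup>2 + (Im z)\<^sup>2, -2 * Re z, 1:]"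
    define s r where "s = q div ?d" and "r = q mod ?d"
    have q: "q = ?d * s + r" by (simp only: s_def r_def mult_div_mod_eq)
    have "degree r < 2"
      using degree_mod_less'[of ?d q] unfolding r_def by (cases "q mod ?d = 0") auto
    moreover obtain u r' where r': "r = pCons u r'" by (rule pCons_cases)
    ultimately have "degree r' = 0" by (cases "r' = 0") auto
    then obtain v where "r' = [:v:]" by (rule degree_eq_zeroE)
    with r' have r: "r = [:u, v:]" by simp
    have d: "poly (map_poly complex_of_real ?d) z = 0"
      by (simp add: poly_of_real_hom complex_eq_iff power2_eq_square algebra_simps)
    have "poly (map_poly complex_of_real r) z = 0"
      using z poly_of_real_hom(2)[of "?d * s" r z] poly_of_real_hom(3)[of ?d s z]
      unfolding q[symmetric] d by (metis add_0 mult_zero_left)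
    then have "of_real u + z * of_real v = 0" by (simp add: r poly_of_real_hom)
    then have "u = 0" "v = 0" using False by (auto simp: complex_eq_iff)
    then show ?thesis using quadratic[of "Im z" "Re z" s] False q by (simp add: r)
  qed
qed

text \<open>The half of the spectral mapping theorem needed here, in real arithmetic only: linear factors
  are invertible off the spectrum, and quadratic factors are coercive because
  \<open>(A - a)\<^sup>2 + b\<^sup>2 \<ge> b\<^sup>2\<close>. Nonreal spectral points never enter.\<close>
lemma invertible_op_poly:
  fixes A :: "'a::chilbert_space \<Rightarrow>\<^sub>L 'a"
  assumes A: "herm A"
  shows "q \<noteq> 0 \<Longrightarrow> (\<And>x. x \<in> rspec A \<Longrightarrow> poly q x \<noteq> 0) \<Longrightarrow> invertible_op (op_poly q A)"
proof (induction "degree q" arbitrary: q rule: less_induct)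
  case less
  show ?case
  proof (cases "degree q = 0")
    case True
    then obtain k where k: "q = [:k:]" by (rule degree_eq_zeroE)
    have "invertible_op (id_blinfun :: 'a \<Rightarrow>\<^sub>L 'a)" unfolding invertible_op_def
      by (rule bexI[of _ id_blinfun]) (auto simp: blinfun_compose_simps bounded_ops_intros)
    then show ?thesis using less.prems(1) by (simp add: k op_poly_const invertible_op_scaleR)
  next
    case False
    have fact: "invertible_op (op_poly q A)"
      if q: "q = d * s" and d: "invertible_op (op_poly d A)" "0 < degree d" for d s
    proof -
      have s: "s \<noteq> 0" "d \<noteq> 0" using less.prems(1) q by auto
      then have "degree s < degree q" using d(2) by (simp add: q degree_mult_eq)
      then have "invertible_op (op_poly s A)" using less.hyps[of s] s less.prems(2) q by auto
      then show ?thesis unfolding q op_poly_mult by (rule invertible_op_compose[OF d(1)])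
    qed
    from False show ?thesis
    proof (cases rule: real_poly_factor)
      case (linear a s)
      then have "a \<notin> rspec A" using less.prems(2)[of a] by auto
      then have "invertible_op (A - a *\<^sub>R id_blinfun)" by (simp add: rspec_iff)
      then have "invertible_op (op_poly [:-a, 1:] A)" by (simp add: op_poly_pCons blinfun_compose_simps)
      from fact[OF linear this] show ?thesis by simp
    next
      case (quadratic a b s)
      have "invertible_op (op_poly [:a\<^sup>2 + b\<^sup>2, -2 * a, 1:] A)"
      proof (rule invertible_op_coercive)
        show "op_poly [:a\<^sup>2 + b\<^sup>2, -2 * a, 1:] A \<in> bounded_ops" by (intro hermD(1) herm_op_poly A)
        show "0 < b\<^sup>2" using quadratic by simp
        fix x
        have "0 \<le> (norm (A x - a *\<^sub>R x))\<^sup>2" by simp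
        also have "\<dots> = rin (A (A x)) x - 2 * a * rin (A x) x + a\<^sup>2 * (norm x)\<^sup>2"
          using hermD(2)[OF A, of "A x" x]
          by (simp add: norm_diff_sq rin.scaleR_right power_mult_distrib rin_self)
        finally show "b\<^sup>2 * (norm x)\<^sup>2 \<le> rin (op_poly [:a\<^sup>2 + b\<^sup>2, -2 * a, 1:] A x) x"
          by (simp add: op_poly_pCons blinfun_compose_simps blinfun.bilinear_simps rin.add_left rin.diff_left
              rin.minus_left rin.scaleR_left rin_self algebra_simps)
      qed
      from fact[OF quadratic(2) this] show ?thesis by simp
    qed
  qed
qed

text \<open>If \<open>r = \<parallel>p(A)\<parallel>\<close> exceeded \<open>c\<close>, then \<open>p\<^sup>2 - r\<^sup>2\<close> would have no zero on the spectrum, and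
  \<open>p(A)\<^sup>2 - r\<^sup>2\<close> would be invertible, which is impossible for the norm \<open>r\<close> of \<open>p(A)\<close>.\<close>
lemma norm_op_poly_le:
  fixes A :: "'a::chilbert_space \<Rightarrow>\<^sub>L 'a"
  assumes A: "herm A" and c: "0 \<le> c" and p: "\<And>x. x \<in> rspec A \<Longrightarrow> \<bar>poly p x\<bar> \<le> c"
  shows "norm (op_poly p A) \<le> c"
proof (rule ccontr)
  let ?B = "op_poly p A"
  define r where "r = norm ?B"
  assume "\<not> norm ?B \<le> c"
  then have r: "c < r" by (simp add: r_def)
  have "?B \<noteq> 0" using r c by (auto simp: r_def)
  then obtain x :: 'a where x: "x \<noteq> 0" by (metis blinfun_eqI zero_blinfun.rep_eq)
  define q where "q = p * p - [:r\<^sup>2:]"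
  have q0: "poly q y \<noteq> 0" if "y \<in> rspec A" for y
  proof -
    have "\<bar>poly p y\<bar> < r" using p[OF that] r by linarith
    then have "\<bar>poly p y\<bar>\<^sup>2 < r\<^sup>2" by (intro power_strict_mono) auto
    then show ?thesis by (simp add: q_def power2_eq_square)
  qed
  show False
  proof (cases "q = 0")
    case False
    have "invertible_op (op_poly q A)" by (rule invertible_op_poly[OF A False q0])
    then have "x = 0" by (intro invertible_norm_square_imp_trivial[OF herm_op_poly[OF A, of p]])
       (simp add: q_def op_poly_diff op_poly_mult op_poly_const r_def)
    then show False using x by simp
  next
    case True
    \<comment> \<open>As \<open>p\<^sup>2 - r\<^sup>2\<close> is negative on the real spectrum, that spectrum would be empty.\<close>
    then have "y \<notin> rspec A" for y using q0[of y] by auto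
    then have "invertible_op (op_poly ([:0,1:] * [:0,1:] - [:(norm A)\<^sup>2:]) A)"
      by (intro invertible_op_poly[OF A]) auto
    then have "x = 0" by (intro invertible_norm_square_imp_trivial[OF A]) (simp only: op_poly_diff op_poly_mult op_poly_const op_poly_X)
    then show False using x by simp
  qed
qed

section \<open>Continuous functional calculus\<close>

text \<open>An interval around the spectrum is what Weierstrass approximation asks for and what the scalar
  estimates refer to.\<close>
definition herm_between :: "real \<Rightarrow> real \<Rightarrow> ('a::complex_inner \<Rightarrow>\<^sub>L 'a) \<Rightarrow> bool" where
  "herm_between a b A \<longleftrightarrow> herm A \<and> rspec A \<subseteq> {a..b}"

lemma herm_betweenD: "herm_between a b A \<Longrightarrow> herm A" "herm_between a b A \<Longrightarrow> rspec A \<subseteq> {a..b}"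
  by (auto simp: herm_between_def)

lemma ex_poly_approx:
  fixes f :: "real \<Rightarrow> real"
  assumes "continuous_on {a..b} f"
  obtains p where "uniform_limit {a..b} (\<lambda>n. poly (p n)) f sequentially"
proof -
  have "\<exists>p. \<forall>x\<in>{a..b}. \<bar>f x - poly p x\<bar> < 1 / real (Suc n)" for n
  proof -
    obtain g where g: "real_polynomial_function g" "\<And>x. x \<in> {a..b} \<Longrightarrow> \<bar>f x - g x\<bar> < 1 / real (Suc n)"
      using Stone_Weierstrass_real_polynomial_function[OF compact_Icc assms, of "1 / real (Suc n)"] by auto
    obtain c m where "g = (\<lambda>x. \<Sum>i\<le>m. c i * x ^ i)"
      using g(1) unfolding real_polynomial_function_iff_sum by auto
    then have "g x = poly (\<Sum>i\<le>m. monom (c i) i) x" for x :: real by (simp add: poly_sum poly_monom)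
    with g(2) show ?thesis by metis
  qed
  then obtain p where p: "\<And>n x. x \<in> {a..b} \<Longrightarrow> \<bar>f x - poly (p n) x\<bar> < 1 / real (Suc n)" by metis
  have "uniform_limit {a..b} (\<lambda>n. poly (p n)) f sequentially"
    unfolding uniform_limit_sequentially_iff
  proof (intro allI impI)
    fix e :: real assume "0 < e"
    then obtain N where N: "1 / real (Suc N) < e" using nat_approx_posE by blast
    have "dist (poly (p n) x) (f x) < e" if "N \<le> n" "x \<in> {a..b}" for n x
    proof -
      have "1 / real (Suc n) \<le> 1 / real (Suc N)" using that(1) by (intro divide_left_mono) auto
      then show ?thesis using p[OF that(2), of n] N by (simp add: dist_real_def abs_minus_commute)
    qed
    then show "\<exists>N. \<forall>n\<ge>N. \<forall>x\<in>{a..b}. dist (poly (p n) x) (f x) < e" by blast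
  qed
  then show ?thesis by (rule that)
qed

lemma op_poly_diff_le:
  fixes A :: "'a::chilbert_space \<Rightarrow>\<^sub>L 'a"
  assumes "herm A" "0 \<le> c" "\<And>x. x \<in> rspec A \<Longrightarrow> \<bar>poly p x - poly q x\<bar> \<le> c"
  shows "norm (op_poly p A - op_poly q A) \<le> c"
  using norm_op_poly_le[OF assms(1,2), of "p - q"] assms(3) by (simp add: op_poly_diff)

text \<open>The definite description in \<open>cfc\<close> is meaningful: two approximating sequences of polynomials
  differ uniformly little on the spectrum, hence so do the operators, by \<open>norm_op_poly_le\<close>; and
  at least one such sequence exists.\<close>
lemma op_poly_limit_cfc:
  fixes A :: "'a::chilbert_space \<Rightarrow>\<^sub>L 'a"
  assumes A: "herm_between a b A" and f: "continuous_on {a..b} f"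
    and p: "uniform_limit (rspec A) (\<lambda>n. poly (p n)) f sequentially"
  shows "(\<lambda>n. op_poly (p n) A) \<longlonglongrightarrow> cfc f A"
proof -
  let ?lim = "\<lambda>p. uniform_limit (rspec A) (\<lambda>n. poly (p n)) f sequentially"
  obtain q where "uniform_limit {a..b} (\<lambda>n. poly (q n)) f sequentially" using ex_poly_approx[OF f] .
  then have q: "?lim q" using herm_betweenD(2)[OF A] by (rule uniform_limit_on_subset)
  have close: "\<exists>N. \<forall>m\<ge>N. \<forall>n\<ge>N. norm (op_poly (r m) A - op_poly (q n) A) < e" if e: "0 < e" and r: "?lim r" for e r
  proof -
    from r[unfolded uniform_limit_sequentially_iff] e obtain M where
      M: "\<And>n x. x \<in> rspec A \<Longrightarrow> n \<ge> M \<Longrightarrow> dist (poly (r n) x) (f x) < e/3" by (meson divide_pos_pos zero_less_numeral)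
    from q[unfolded uniform_limit_sequentially_iff] e obtain N where
      N: "\<And>n x. x \<in> rspec A \<Longrightarrow> n \<ge> N \<Longrightarrow> dist (poly (q n) x) (f x) < e/3" by (meson divide_pos_pos zero_less_numeral)
    have "norm (op_poly (r m) A - op_poly (q n) A) \<le> 2 * e / 3" if "m \<ge> max M N" "n \<ge> max M N" for m n
    proof (rule op_poly_diff_le)
      fix x assume x: "x \<in> rspec A"
      have "M \<le> m" "N \<le> n" using that by simp_all
      then have "\<bar>poly (r m) x - f x\<bar> < e/3" "\<bar>poly (q n) x - f x\<bar> < e/3"
        using M[OF x] N[OF x] by (simp_all add: dist_real_def)
      then show "\<bar>poly (r m) x - poly (q n) x\<bar> \<le> 2 * e / 3" by linarith
    qed (use herm_betweenD(1)[OF A] e in auto)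
    moreover have "2 * e / 3 < e" using e by simp
    ultimately show ?thesis by (meson le_less_trans)
  qed
  have "Cauchy (\<lambda>n. op_poly (q n) A)"
    unfolding Cauchy_def dist_norm using close[OF _ q] by blast
  then obtain B where B: "(\<lambda>n. op_poly (q n) A) \<longlonglongrightarrow> B" using Cauchy_convergent convergent_def by blast
  have all: "(\<lambda>n. op_poly (r n) A) \<longlonglongrightarrow> B" if r: "?lim r" for r
  proof -
    have "(\<lambda>n. op_poly (r n) A - op_poly (q n) A) \<longlonglongrightarrow> 0"
      unfolding LIMSEQ_iff using close[OF _ r] by (metis diff_zero)
    from tendsto_add[OF this B] show ?thesis by simp
  qed
  have "cfc f A = B" unfolding cfc_def
  proof (rule the_equality)
    show "\<forall>p. ?lim p \<longrightarrow> (\<lambda>n. op_poly (p n) A) \<longlonglongrightarrow> B" using all by blast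
    show "C = B" if "\<forall>p. ?lim p \<longrightarrow> (\<lambda>n. op_poly (p n) A) \<longlonglongrightarrow> C" for C
      using that q B LIMSEQ_unique by blast
  qed
  then show ?thesis using all[OF p] by simp
qed

lemma cfc_approx:
  fixes A :: "'a::chilbert_space \<Rightarrow>\<^sub>L 'a"
  assumes A: "herm_between a b A" and f: "continuous_on {a..b} f"
  obtains p where "uniform_limit {a..b} (\<lambda>n. poly (p n)) f sequentially"
    "(\<lambda>n. op_poly (p n) A) \<longlonglongrightarrow> cfc f A"
proof -
  obtain p where p: "uniform_limit {a..b} (\<lambda>n. poly (p n)) f sequentially" using ex_poly_approx[OF f] .
  then show ?thesis
    using op_poly_limit_cfc[OF A f uniform_limit_on_subset[OF p herm_betweenD(2)[OF A]]] that by blast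
qed

lemma cfc_eqI:
  fixes A :: "'a::chilbert_space \<Rightarrow>\<^sub>L 'a"
  assumes A: "herm_between a b A" and f: "continuous_on {a..b} f"
    and p: "uniform_limit {a..b} (\<lambda>n. poly (p n)) f sequentially" "(\<lambda>n. op_poly (p n) A) \<longlonglongrightarrow> B"
  shows "cfc f A = B"
  using op_poly_limit_cfc[OF A f uniform_limit_on_subset[OF p(1) herm_betweenD(2)[OF A]]] p(2) LIMSEQ_unique by blast

lemma cfc_poly:
  fixes A :: "'a::chilbert_space \<Rightarrow>\<^sub>L 'a"
  assumes A: "herm_between a b A" shows "cfc (poly p) A = op_poly p A"
  by (rule cfc_eqI[OF A, of _ "\<lambda>_. p"]) (auto intro: uniform_limit_const continuous_intros)

lemma cfc_cong:
  fixes A :: "'a::chilbert_space \<Rightarrow>\<^sub>L 'a"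
  assumes A: "herm_between a b A" and f: "continuous_on {a..b} f" and eq: "\<And>x. x \<in> {a..b} \<Longrightarrow> g x = f x"
  shows "cfc g A = cfc f A"
proof -
  obtain p where p: "uniform_limit {a..b} (\<lambda>n. poly (p n)) f sequentially"
    "(\<lambda>n. op_poly (p n) A) \<longlonglongrightarrow> cfc f A" using cfc_approx[OF A f] .
  have "continuous_on {a..b} g" using f continuous_on_cong[of "{a..b}" "{a..b}" g f] eq by simp
  moreover have "uniform_limit {a..b} (\<lambda>n. poly (p n)) g sequentially"
    using p(1) by (rule uniform_limit_cong'[THEN iffD1, rotated -1]) (use eq in auto)
  ultimately show ?thesis using p(2) by (rule cfc_eqI[OF A])
qed

lemma cfc_const:
  fixes A :: "'a::chilbert_space \<Rightarrow>\<^sub>L 'a"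
  assumes A: "herm_between a b A" shows "cfc (\<lambda>_. c) A = c *\<^sub>R id_blinfun"
proof -
  have "(\<lambda>_. c) = poly [:c:]" by auto
  then show ?thesis using cfc_poly[OF A, of "[:c:]"] by (simp only: op_poly_const)
qed

lemma cfc_ident:
  fixes A :: "'a::chilbert_space \<Rightarrow>\<^sub>L 'a"
  assumes A: "herm_between a b A" shows "cfc (\<lambda>x. x) A = A"
proof -
  have "(\<lambda>x. x) = poly [:0, 1::real:]" by auto
  then show ?thesis using cfc_poly[OF A, of "[:0,1:]"] by (simp only: op_poly_X)
qed

lemma cfc_mult:
  fixes A :: "'a::chilbert_space \<Rightarrow>\<^sub>L 'a"
  assumes A: "herm_between a b A" and f: "continuous_on {a..b} f" and g: "continuous_on {a..b} g"
  shows "cfc (\<lambda>x. f x * g x) A = cfc f A o\<^sub>L cfc g A"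
proof -
  obtain p where p: "uniform_limit {a..b} (\<lambda>n. poly (p n)) f sequentially"
    "(\<lambda>n. op_poly (p n) A) \<longlonglongrightarrow> cfc f A" using cfc_approx[OF A f] .
  obtain q where q: "uniform_limit {a..b} (\<lambda>n. poly (q n)) g sequentially"
    "(\<lambda>n. op_poly (q n) A) \<longlonglongrightarrow> cfc g A" using cfc_approx[OF A g] .
  show ?thesis
  proof (rule cfc_eqI[OF A])
    have "uniform_limit {a..b} (\<lambda>n x. poly (p n) x * poly (q n) x) (\<lambda>x. f x * g x) sequentially"
      by (intro uniform_lim_mult p q compact_imp_bounded compact_continuous_image f g compact_Icc)
    then show "uniform_limit {a..b} (\<lambda>n. poly (p n * q n)) (\<lambda>x. f x * g x) sequentially"
      by (simp add: fun_eq_iff[of "poly _"] poly_mult[abs_def])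
    show "(\<lambda>n. op_poly (p n * q n) A) \<longlonglongrightarrow> (cfc f A o\<^sub>L cfc g A)"
      unfolding op_poly_mult by (intro bounded_bilinear.tendsto[OF bounded_bilinear_blinfun_compose] p q)
  qed (intro continuous_intros f g)
qed

lemma cfc_add:
  fixes A :: "'a::chilbert_space \<Rightarrow>\<^sub>L 'a"
  assumes A: "herm_between a b A" and f: "continuous_on {a..b} f" and g: "continuous_on {a..b} g"
  shows "cfc (\<lambda>x. f x + g x) A = cfc f A + cfc g A"
proof -
  obtain p where p: "uniform_limit {a..b} (\<lambda>n. poly (p n)) f sequentially"
    "(\<lambda>n. op_poly (p n) A) \<longlonglongrightarrow> cfc f A" using cfc_approx[OF A f] .
  obtain q where q: "uniform_limit {a..b} (\<lambda>n. poly (q n)) g sequentially"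
    "(\<lambda>n. op_poly (q n) A) \<longlonglongrightarrow> cfc g A" using cfc_approx[OF A g] .
  show ?thesis
  proof (rule cfc_eqI[OF A])
    have "uniform_limit {a..b} (\<lambda>n x. poly (p n) x + poly (q n) x) (\<lambda>x. f x + g x) sequentially"
      by (intro uniform_limit_add p q)
    then show "uniform_limit {a..b} (\<lambda>n. poly (p n + q n)) (\<lambda>x. f x + g x) sequentially"
      by (simp add: poly_add[abs_def])
    show "(\<lambda>n. op_poly (p n + q n) A) \<longlonglongrightarrow> cfc f A + cfc g A"
      unfolding op_poly_add by (intro tendsto_intros p q)
  qed (intro continuous_intros f g)
qed

lemma cfc_scaleR:
  fixes A :: "'a::chilbert_space \<Rightarrow>\<^sub>L 'a"
  assumes A: "herm_between a b A" and f: "continuous_on {a..b} f"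
  shows "cfc (\<lambda>x. c * f x) A = c *\<^sub>R cfc f A"
  using cfc_mult[OF A continuous_on_const f, of c] by (simp add: cfc_const[OF A] blinfun_compose_simps)

lemma cfc_diff:
  fixes A :: "'a::chilbert_space \<Rightarrow>\<^sub>L 'a"
  assumes A: "herm_between a b A" and f: "continuous_on {a..b} f" and g: "continuous_on {a..b} g"
  shows "cfc (\<lambda>x. f x - g x) A = cfc f A - cfc g A"
  using cfc_add[OF A f continuous_on_mult[OF continuous_on_const g, of "-1"]] cfc_scaleR[OF A g, of "-1"] by simp

lemma herm_cfc:
  fixes A :: "'a::chilbert_space \<Rightarrow>\<^sub>L 'a"
  assumes A: "herm_between a b A" and f: "continuous_on {a..b} f"
  shows "herm (cfc f A)"
proof -
  obtain p where p: "uniform_limit {a..b} (\<lambda>n. poly (p n)) f sequentially"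
    "(\<lambda>n. op_poly (p n) A) \<longlonglongrightarrow> cfc f A" using cfc_approx[OF A f] .
  show ?thesis using herm_op_poly[OF herm_betweenD(1)[OF A]] p(2) by (rule herm_limit)
qed

lemma norm_cfc_le:
  fixes A :: "'a::chilbert_space \<Rightarrow>\<^sub>L 'a"
  assumes A: "herm_between a b A" and f: "continuous_on {a..b} f"
    and c: "0 \<le> c" "\<And>x. x \<in> {a..b} \<Longrightarrow> \<bar>f x\<bar> \<le> c"
  shows "norm (cfc f A) \<le> c"
proof (rule field_le_epsilon)
  fix e :: real assume e: "0 < e"
  obtain p where p: "uniform_limit {a..b} (\<lambda>n. poly (p n)) f sequentially"
    "(\<lambda>n. op_poly (p n) A) \<longlonglongrightarrow> cfc f A" using cfc_approx[OF A f] .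
  have ev: "\<forall>\<^sub>F n in sequentially. norm (op_poly (p n) A) \<le> c + e"
    using uniform_limitD[OF p(1) e]
  proof eventually_elim
    case (elim n)
    show ?case
    proof (rule norm_op_poly_le)
      fix x assume "x \<in> rspec A"
      then have "x \<in> {a..b}" using herm_betweenD(2)[OF A] by blast
      then show "\<bar>poly (p n) x\<bar> \<le> c + e" using elim c(2)[of x] unfolding dist_real_def by fastforce
    qed (use herm_betweenD(1)[OF A] c e in auto)
  qed
  show "norm (cfc f A) \<le> c + e"
    by (rule tendsto_upperbound[OF tendsto_norm[OF p(2)] ev]) simp
qed

lemma cfc_inverse:
  fixes A :: "'a::chilbert_space \<Rightarrow>\<^sub>L 'a"
  assumes A: "herm_between a b A" and f: "continuous_on {a..b} f" and g: "continuous_on {a..b} g"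
    and 1: "\<And>x. x \<in> {a..b} \<Longrightarrow> f x * g x = 1"
  shows "cfc f A o\<^sub>L cfc g A = id_blinfun"
proof -
  have "cfc (\<lambda>x. f x * g x) A = cfc (\<lambda>_. 1) A" using 1 by (intro cfc_cong[OF A]) auto
  then show ?thesis using cfc_mult[OF A f g] cfc_const[OF A, of 1] by simp
qed

text \<open>For \<open>x\<close> outside the range of \<open>f\<close>, the function \<open>1 / (f - x)\<close> is continuous and its calculus
  inverts \<open>f(A) - x\<close>.\<close>
lemma herm_between_cfc:
  fixes A :: "'a::chilbert_space \<Rightarrow>\<^sub>L 'a"
  assumes A: "herm_between a b A" and f: "continuous_on {a..b} f" and im: "f ` {a..b} \<subseteq> {c..d}"
  shows "herm_between c d (cfc f A)"
  unfolding herm_between_def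
proof (intro conjI herm_cfc[OF A f] subsetI, rule ccontr)
  fix x assume x: "x \<in> rspec (cfc f A)" "x \<notin> {c..d}"
  have nz: "f y - x \<noteq> 0" if "y \<in> {a..b}" for y
  proof -
    have "f y \<in> {c..d}" using that im by blast
    then show ?thesis using x(2) by auto
  qed
  have c1: "continuous_on {a..b} (\<lambda>y. f y - x)" by (intro continuous_intros f)
  have c2: "continuous_on {a..b} (\<lambda>y. 1 / (f y - x))" using nz by (intro continuous_intros c1) auto
  have eq: "cfc (\<lambda>y. f y - x) A = cfc f A - x *\<^sub>R id_blinfun"
    by (simp add: cfc_diff[OF A f continuous_on_const] cfc_const[OF A])
  have "invertible_op (cfc f A - x *\<^sub>R id_blinfun)"
    unfolding eq[symmetric]
  proof (rule invertible_opI)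
    show "cfc (\<lambda>y. 1 / (f y - x)) A \<in> bounded_ops" by (rule hermD(1)[OF herm_cfc[OF A c2]])
    show "cfc (\<lambda>y. 1 / (f y - x)) A o\<^sub>L cfc (\<lambda>y. f y - x) A = id_blinfun"
      using nz by (intro cfc_inverse[OF A c2 c1]) simp
    show "cfc (\<lambda>y. f y - x) A o\<^sub>L cfc (\<lambda>y. 1 / (f y - x)) A = id_blinfun"
      using nz by (intro cfc_inverse[OF A c1 c2]) simp
  qed
  then show False using x(1) by (simp add: rspec_iff)
qed

lemma op_poly_cfc:
  fixes A :: "'a::chilbert_space \<Rightarrow>\<^sub>L 'a"
  assumes A: "herm_between a b A" and f: "continuous_on {a..b} f"
  shows "op_poly p (cfc f A) = cfc (\<lambda>x. poly p (f x)) A"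
proof (induction p)
  case 0 then show ?case using cfc_const[OF A, of 0] by simp
next
  case (pCons k p)
  have c: "continuous_on {a..b} (\<lambda>x. poly p (f x))" by (intro continuous_intros f)
  show ?case
    by (simp add: op_poly_pCons pCons cfc_const[OF A] cfc_mult[OF A f c]
       cfc_add[OF A continuous_on_const continuous_on_mult[OF f c]])
qed

text \<open>For polynomials \<open>g\<close> this is the homomorphism property, and both sides depend continuously on \<open>g\<close>
  in the supremum norm of \<open>[c, d]\<close>.\<close>
lemma cfc_compose:
  fixes A :: "'a::chilbert_space \<Rightarrow>\<^sub>L 'a"
  assumes A: "herm_between a b A" and f: "continuous_on {a..b} f" and im: "f ` {a..b} \<subseteq> {c..d}"
    and g: "continuous_on {c..d} g"
  shows "cfc g (cfc f A) = cfc (\<lambda>x. g (f x)) A"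
proof -
  have gf: "continuous_on {a..b} (\<lambda>x. g (f x))" using continuous_on_compose2[OF g f im] .
  obtain p where p: "uniform_limit {c..d} (\<lambda>n. poly (p n)) g sequentially" using ex_poly_approx[OF g] .
  have "(\<lambda>n. op_poly (p n) (cfc f A)) \<longlonglongrightarrow> cfc (\<lambda>x. g (f x)) A"
  proof (rule metric_LIMSEQ_I)
    fix e :: real assume e: "0 < e"
    then obtain N where N: "\<And>n x. x \<in> {c..d} \<Longrightarrow> n \<ge> N \<Longrightarrow> dist (poly (p n) x) (g x) < e/2"
      using p[unfolded uniform_limit_sequentially_iff] by (meson half_gt_zero)
    have "dist (op_poly (p n) (cfc f A)) (cfc (\<lambda>x. g (f x)) A) < e" if "N \<le> n" for n
    proof -
      have c: "continuous_on {a..b} (\<lambda>x. poly (p n) (f x))" by (intro continuous_intros f)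
      have "norm (cfc (\<lambda>x. poly (p n) (f x) - g (f x)) A) \<le> e/2"
      proof (rule norm_cfc_le[OF A])
        fix x assume "x \<in> {a..b}"
        then have "f x \<in> {c..d}" using im by blast
        from N[OF this that] show "\<bar>poly (p n) (f x) - g (f x)\<bar> \<le> e/2" by (simp add: dist_real_def)
      qed (use e in \<open>auto intro!: continuous_intros c gf\<close>)
      then show ?thesis using e by (simp add: op_poly_cfc[OF A f] cfc_diff[OF A c gf] dist_norm)
    qed
    then show "\<exists>N. \<forall>n\<ge>N. dist (op_poly (p n) (cfc f A)) (cfc (\<lambda>x. g (f x)) A) < e" by blast
  qed
  then show ?thesis by (rule cfc_eqI[OF herm_between_cfc[OF A f im] g p])
qed

section \<open>Lipschitz continuity of the logarithm\<close>

text \<open>The logarithm is expanded at the right end point \<open>b\<close>, so that the argument \<open>1 - x / b\<close> of the power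
  series stays in \<open>[0, \<rho>]\<close> with \<open>\<rho> = 1 - a / b < 1\<close> on the whole interval.\<close>
lemma ln_poly_approx:
  fixes a b :: real
  assumes ab: "0 < a" "a \<le> b"
  shows "uniform_limit {a..b}
    (\<lambda>n. poly ([:ln b:] - (\<Sum>k<n. smult (1 / real (Suc k)) ([:1, - 1 / b:] ^ Suc k)))) ln sequentially"
proof -
  define \<rho> where "\<rho> = 1 - a / b"
  have \<rho>: "0 \<le> \<rho>" "\<rho> < 1" using ab by (auto simp: \<rho>_def)
  have y: "0 \<le> 1 - x / b" "1 - x / b \<le> \<rho>" if "x \<in> {a..b}" for x
    using that ab by (auto simp: \<rho>_def divide_right_mono)
  let ?t = "\<lambda>k x. (1 - x / b) ^ Suc k / real (Suc k)"
  have "uniform_limit {a..b} (\<lambda>n x. \<Sum>k<n. ?t k x) (\<lambda>x. suminf (\<lambda>k. ?t k x)) sequentially"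
  proof (rule Weierstrass_m_test)
    show "norm (?t k x) \<le> \<rho> ^ k" if "x \<in> {a..b}" for k x
    proof -
      have "(1 - x / b) ^ Suc k \<le> \<rho> ^ Suc k" using y[OF that] by (intro power_mono)
      also have "\<dots> \<le> \<rho> ^ k" using \<rho> by (simp add: mult_left_le_one_le)
      finally have "(1 - x / b) ^ Suc k / real (Suc k) \<le> \<rho> ^ k / 1"
        using \<rho> by (intro frac_le) auto
      then show ?thesis using y[OF that] by (simp add: abs_mult power_abs)
    qed
    show "summable ((^) \<rho>)" using \<rho> by (intro summable_geometric) simp
  qed
  moreover have "suminf (\<lambda>k. ?t k x) = ln b - ln x" if "x \<in> {a..b}" for x
  proof -
    have "\<bar>x / b - 1\<bar> < 1" using y[OF that] \<rho> by simp
    from ln_series'[OF this] have "(\<lambda>n. - ((1 - x / b) ^ n) / real n) sums ln (x / b)" by simp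
    then have "(\<lambda>k. - ((1 - x / b) ^ Suc k) / real (Suc k)) sums ln (x / b)"
      by (subst sums_Suc_iff) simp
    then have "(\<lambda>k. ?t k x) sums - ln (x / b)" using sums_minus by fastforce
    then show ?thesis using that ab by (simp add: sums_iff ln_div)
  qed
  ultimately have "uniform_limit {a..b} (\<lambda>n x. \<Sum>k<n. ?t k x) (\<lambda>x. ln b - ln x) sequentially"
    by (subst (asm) uniform_limit_cong'[where g="\<lambda>n x. \<Sum>k<n. ?t k x" and i="\<lambda>x. ln b - ln x"]) auto
  then have "uniform_limit {a..b} (\<lambda>n x. ln b - (\<Sum>k<n. ?t k x)) (\<lambda>x. ln b - (ln b - ln x)) sequentially"
    by (intro uniform_limit_minus uniform_limit_const)
  moreover have "(\<lambda>n. poly ([:ln b:] - (\<Sum>k<n. smult (1 / real (Suc k)) ([:1, - 1 / b:] ^ Suc k))))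
      = (\<lambda>n x. ln b - (\<Sum>k<n. ?t k x))"
    by (intro ext) (simp add: poly_sum poly_power del: power_Suc of_nat_Suc)
  ultimately show ?thesis by simp
qed

text \<open>The telescoping identity \<open>R\<^sup>k\<^sup>+\<^sup>1 - S\<^sup>k\<^sup>+\<^sup>1 = R (R\<^sup>k - S\<^sup>k) + (R - S) S\<^sup>k\<close> holds also for
  operators that do not commute.\<close>
lemma op_poly_power_lipschitz:
  fixes A B :: "'a::chilbert_space \<Rightarrow>\<^sub>L 'a"
  assumes A: "herm A" "\<And>x. x \<in> rspec A \<Longrightarrow> \<bar>poly r x\<bar> \<le> \<rho>"
    and B: "herm B" "\<And>x. x \<in> rspec B \<Longrightarrow> \<bar>poly r x\<bar> \<le> \<rho>" and \<rho>: "0 \<le> \<rho>"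
  shows "norm (op_poly (r ^ Suc k) A - op_poly (r ^ Suc k) B)
    \<le> real (Suc k) * \<rho> ^ k * norm (op_poly r A - op_poly r B)"
proof (induction k)
  case (Suc k)
  let ?d = "norm (op_poly r A - op_poly r B)"
  have "op_poly (r ^ Suc (Suc k)) A - op_poly (r ^ Suc (Suc k)) B
      = (op_poly r A o\<^sub>L (op_poly (r ^ Suc k) A - op_poly (r ^ Suc k) B))
        + ((op_poly r A - op_poly r B) o\<^sub>L op_poly (r ^ Suc k) B)"
    unfolding power_Suc[of r "Suc k"] op_poly_mult by (simp add: blinfun_compose_simps)
  also have "norm \<dots> \<le> \<rho> * (real (Suc k) * \<rho> ^ k * ?d) + ?d * \<rho> ^ Suc k"
  proof (intro norm_triangle_le add_mono order_trans[OF norm_blinfun_compose] mult_mono Suc order_refl)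
    show "norm (op_poly r A) \<le> \<rho>" by (rule norm_op_poly_le[OF A(1) \<rho> A(2)])
    show "norm (op_poly (r ^ Suc k) B) \<le> \<rho> ^ Suc k"
    proof (rule norm_op_poly_le[OF B(1)])
      fix x assume "x \<in> rspec B"
      then show "\<bar>poly (r ^ Suc k) x\<bar> \<le> \<rho> ^ Suc k"
        using power_mono[OF B(2), of x "Suc k"] by (simp only: poly_power power_abs)
    qed (use \<rho> in simp)
  qed (use \<rho> in auto)
  also have "\<dots> = real (Suc (Suc k)) * \<rho> ^ Suc k * ?d" by (simp add: algebra_simps)
  finally show ?case .
qed simp

text \<open>Termwise estimate of the power series: the factor \<open>k\<close> from the derivative of the \<open>k\<close>-th power cancels
  the coefficient \<open>1 / k\<close>, and the remaining geometric series sums to \<open>b / a\<close>.\<close>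
lemma cfc_ln_lipschitz:
  fixes A B :: "'a::chilbert_space \<Rightarrow>\<^sub>L 'a"
  assumes A: "herm_between a b A" and B: "herm_between a b B" and ab: "0 < a" "a \<le> b"
  shows "norm (cfc ln A - cfc ln B) \<le> norm (A - B) / a"
proof -
  let ?r = "[:1, - 1 / b:]"
  let ?p = "\<lambda>n. [:ln b:] - (\<Sum>k<n. smult (1 / real (Suc k)) (?r ^ Suc k))"
  have c: "continuous_on {a..b} ln" using ab by (intro continuous_intros) auto
  have lim: "(\<lambda>n. op_poly (?p n) C) \<longlonglongrightarrow> cfc ln C" if "herm_between a b C" for C :: "'a \<Rightarrow>\<^sub>L 'a"
    by (rule op_poly_limit_cfc[OF that c uniform_limit_on_subset[OF ln_poly_approx[OF ab] herm_betweenD(2)[OF that]]])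
  define \<rho> where "\<rho> = 1 - a / b"
  have \<rho>: "0 \<le> \<rho>" "\<rho> < 1" using ab by (auto simp: \<rho>_def)
  have sp: "\<bar>poly ?r x\<bar> \<le> \<rho>" if "x \<in> rspec C" "herm_between a b C" for x and C :: "'a \<Rightarrow>\<^sub>L 'a"
  proof -
    have "x \<in> {a..b}" using that herm_betweenD(2) by blast
    then show ?thesis using ab by (auto simp: \<rho>_def divide_right_mono)
  qed
  have rd: "norm (op_poly ?r A - op_poly ?r B) = norm (A - B) / b"
  proof -
    have "op_poly ?r A - op_poly ?r B = (- 1 / b) *\<^sub>R (A - B)"
      by (simp add: op_poly_pCons scaleR_minus_left[symmetric] blinfun_compose_simps scaleR_diff_right
          del: scaleR_minus_left)
    then show ?thesis using ab by simp
  qed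
  have op_sum: "op_poly (\<Sum>k<n. q k) C = (\<Sum>k<n. op_poly (q k) C)" for q and n :: nat and C :: "'a \<Rightarrow>\<^sub>L 'a"
    by (induction n) (auto simp: op_poly_add)
  have bound: "norm (op_poly (?p n) A - op_poly (?p n) B) \<le> norm (A - B) / a" for n
  proof -
    have "op_poly (?p n) A - op_poly (?p n) B
      = - (\<Sum>k<n. (1 / real (Suc k)) *\<^sub>R (op_poly (?r ^ Suc k) A - op_poly (?r ^ Suc k) B))"
      by (simp add: op_poly_diff op_sum op_poly_const op_poly_smult sum_subtractf scaleR_diff_right
          del: power_Suc)
    also have "norm \<dots> \<le> (\<Sum>k<n. norm ((1 / real (Suc k)) *\<^sub>R (op_poly (?r ^ Suc k) A - op_poly (?r ^ Suc k) B)))"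
      unfolding norm_minus_cancel by (rule norm_sum)
    also have "\<dots> \<le> (\<Sum>k<n. \<rho> ^ k * (norm (A - B) / b))"
    proof (rule sum_mono)
      fix k
      have "norm (op_poly (?r ^ Suc k) A - op_poly (?r ^ Suc k) B) \<le> real (Suc k) * \<rho> ^ k * (norm (A - B) / b)"
        using op_poly_power_lipschitz[OF herm_betweenD(1)[OF A] sp[OF _ A] herm_betweenD(1)[OF B] sp[OF _ B] \<rho>(1), of k]
        unfolding rd by simp
      then show "norm ((1 / real (Suc k)) *\<^sub>R (op_poly (?r ^ Suc k) A - op_poly (?r ^ Suc k) B))
          \<le> \<rho> ^ k * (norm (A - B) / b)"
        by (simp add: divide_le_eq mult_ac del: power_Suc)
    qed
    also have "\<dots> = (\<Sum>k<n. \<rho> ^ k) * (norm (A - B) / b)" by (simp only: sum_distrib_right)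
    also have "\<dots> \<le> (1 / (1 - \<rho>)) * (norm (A - B) / b)"
    proof (rule mult_right_mono)
      show "(\<Sum>k<n. \<rho> ^ k) \<le> 1 / (1 - \<rho>)"
        using sum_le_suminf[of "\<lambda>k. \<rho> ^ k" "{..<n}"] \<rho> by (simp add: suminf_geometric summable_geometric)
    qed (use ab in simp)
    also have "\<dots> = norm (A - B) / a" using ab by (simp add: \<rho>_def)
    finally show ?thesis .
  qed
  show ?thesis
    by (rule tendsto_upperbound[OF tendsto_norm[OF tendsto_diff[OF lim[OF A] lim[OF B]]]])
      (use bound in auto)
qed

section \<open>One-step schemes on closed subsets of Banach spaces\<close>

text \<open>Both sequences follow the Euler method up to a local error, and local errors are amplified at most
  by \<open>(1 + L h)\<^sup>n \<le> exp (L n h)\<close>. It serves twice: to compare the scheme with a solution, and to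
  compare the scheme with itself at half the step size.\<close>
lemma discrete_gronwall:
  fixes x y :: "nat \<Rightarrow> 'b::real_normed_vector"
  assumes L: "0 \<le> L" "0 \<le> h" and E: "0 \<le> E"
    and lip: "\<And>k. norm (f (x k) - f (y k)) \<le> L * norm (x k - y k)"
    and x: "\<And>k. k < n \<Longrightarrow> norm (x (Suc k) - x k - h *\<^sub>R f (x k)) \<le> E"
    and y: "\<And>k. k < n \<Longrightarrow> norm (y (Suc k) - y k - h *\<^sub>R f (y k)) \<le> E'"
    and E': "0 \<le> E'" and 0: "x 0 = y 0"
  shows "norm (x n - y n) \<le> real n * (E + E') * exp (L * (real n * h))"
proof -
  have step: "norm (x (Suc k) - y (Suc k)) \<le> (1 + L * h) * norm (x k - y k) + (E + E')" if k: "k < n" for k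
  proof -
    have "x (Suc k) - y (Suc k) = (x k - y k) + h *\<^sub>R (f (x k) - f (y k))
        + ((x (Suc k) - x k - h *\<^sub>R f (x k)) - (y (Suc k) - y k - h *\<^sub>R f (y k)))"
      by (simp add: algebra_simps)
    also have "norm \<dots> \<le> norm (x k - y k) + h * (L * norm (x k - y k)) + (E + E')"
      by (intro norm_triangle_le add_mono norm_triangle_le_diff x y k order_refl)
         (use L lip[of k] in \<open>auto intro: mult_left_mono\<close>)
    finally show ?thesis by (simp add: algebra_simps)
  qed
  have "norm (x k - y k) \<le> real k * (E + E') * (1 + L * h) ^ k" if "k \<le> n" for k
    using that
  proof (induction k)
    case 0 then show ?case using \<open>x 0 = y 0\<close> by simp
  next
    case (Suc k)
    have "1 \<le> (1 + L * h) ^ Suc k" using L by (intro one_le_power) simp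
    then have "E + E' \<le> (E + E') * (1 + L * h) ^ Suc k" using E E' by (simp add: mult_left_le mult_le_cancel_left1)
    moreover have "(1 + L * h) * norm (x k - y k) \<le> (1 + L * h) * (real k * (E + E') * (1 + L * h) ^ k)"
      using Suc L by (intro mult_left_mono) auto
    moreover have "k < n" using Suc by simp
    ultimately show ?case using step[of k] by (simp add: algebra_simps)
  qed
  then have "norm (x n - y n) \<le> real n * (E + E') * (1 + L * h) ^ n" by simp
  also have "(1 + L * h) ^ n \<le> exp (L * h) ^ n" using L by (intro power_mono exp_ge_add_one_self) auto
  also have "exp (L * h) ^ n = exp (L * (real n * h))" by (simp add: exp_of_nat_mult[symmetric] mult_ac)
  finally show ?thesis using E E' by (simp add: mult_left_mono)
qed

text \<open>The set \<open>S\<close> need not be convex. Its invariance under the scheme replaces a global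
  Lipschitz condition: the iterates never leave the region where the estimates hold.\<close>
locale one_step_scheme =
  fixes S :: "'b::real_normed_vector set" and f :: "'b \<Rightarrow> 'b" and \<Phi> :: "real \<Rightarrow> 'b \<Rightarrow> 'b"
    and L F C :: real
  assumes lip: "\<And>a b. a \<in> S \<Longrightarrow> b \<in> S \<Longrightarrow> norm (f a - f b) \<le> L * norm (a - b)"
    and bnd: "\<And>a. a \<in> S \<Longrightarrow> norm (f a) \<le> F"
    and inv: "\<And>h a. 0 \<le> h \<Longrightarrow> h < 1 \<Longrightarrow> a \<in> S \<Longrightarrow> \<Phi> h a \<in> S"
    and consistent: "\<And>h a. 0 \<le> h \<Longrightarrow> h < 1 \<Longrightarrow> a \<in> S \<Longrightarrow> norm (\<Phi> h a - a - h *\<^sub>R f a) \<le> C * h\<^sup>2"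
    and L0: "0 \<le> L" and F0: "0 \<le> F" and C0: "0 \<le> C"
begin

lemma iterate_in: "a \<in> S \<Longrightarrow> 0 \<le> h \<Longrightarrow> h < 1 \<Longrightarrow> (\<Phi> h ^^ k) a \<in> S"
  by (induction k) (auto intro: inv)

text \<open>A solution moves with speed at most \<open>F\<close>, so its velocity changes by at most \<open>L F (t - s)\<close> on the
  interval; the mean value inequality turns this into a quadratic error of the Euler step.\<close>
lemma solution_step:
  assumes X: "\<And>t. 0 \<le> t \<Longrightarrow> t \<le> \<tau> \<Longrightarrow> X t \<in> S \<and> (X has_vector_derivative f (X t)) (at t within {0..})"
    and st: "0 \<le> s" "s \<le> t" "t \<le> \<tau>"
  shows "norm (X t - X s - (t - s) *\<^sub>R f (X s)) \<le> L * F * (t - s)\<^sup>2"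
proof -
  have d: "(X has_vector_derivative f (X u)) (at u within {s..t})" if "u \<in> {s..t}" for u
    using X[of u] that st by (auto intro: has_vector_derivative_within_subset)
  have lipX: "norm (X u - X s) \<le> F * (u - s)" if u: "u \<in> {s..t}" for u
  proof -
    have "norm (X u - X s) \<le> F * norm (u - s)"
    proof (rule differentiable_bound[where S="{s..t}" and f'="\<lambda>u v. v *\<^sub>R f (X u)"])
      show "(X has_derivative (\<lambda>v. v *\<^sub>R f (X u))) (at u within {s..t})" if "u \<in> {s..t}" for u
        using d[OF that] by (simp add: has_vector_derivative_def)
      show "onorm (\<lambda>v. v *\<^sub>R f (X u)) \<le> F" if "u \<in> {s..t}" for u
        using bnd[of "X u"] X[of u] that st
        by (intro onorm_le) (auto simp: mult.commute[of F] intro!: mult_left_mono)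
    qed (use u st in auto)
    then show ?thesis using u by simp
  qed
  let ?g = "\<lambda>u. X u - u *\<^sub>R f (X s)"
  have "norm (?g t - ?g s) \<le> (L * F * (t - s)) * norm (t - s)"
  proof (rule differentiable_bound[where S="{s..t}" and f'="\<lambda>u v. v *\<^sub>R f (X u) - v *\<^sub>R f (X s)"])
    show "(?g has_derivative (\<lambda>v. v *\<^sub>R f (X u) - v *\<^sub>R f (X s))) (at u within {s..t})" if "u \<in> {s..t}" for u
      using d[OF that] by (auto simp: has_vector_derivative_def intro!: derivative_intros)
    show "onorm (\<lambda>v. v *\<^sub>R f (X u) - v *\<^sub>R f (X s)) \<le> L * F * (t - s)" if u: "u \<in> {s..t}" for u
    proof (rule onorm_le)
      fix v :: real
      have "norm (f (X u) - f (X s)) \<le> L * norm (X u - X s)"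
        using X[of u] X[of s] u st by (intro lip) auto
      also have "\<dots> \<le> L * (F * (u - s))" using lipX[OF u] L0 by (intro mult_left_mono)
      also have "\<dots> \<le> L * (F * (t - s))" using u L0 F0 by (intro mult_left_mono) auto
      finally have "norm (f (X u) - f (X s)) \<le> L * F * (t - s)" by simp
      then show "norm (v *\<^sub>R f (X u) - v *\<^sub>R f (X s)) \<le> L * F * (t - s) * norm v"
        by (simp add: scaleR_diff_right[symmetric] mult.commute[of _ "\<bar>v\<bar>"] mult_left_mono)
    qed
  qed (use st in auto)
  then show ?thesis using st by (simp add: algebra_simps power2_eq_square)
qed

lemma scheme_converges_to_solution:
  assumes X: "\<And>t. 0 \<le> t \<Longrightarrow> t \<le> \<tau> \<Longrightarrow> X t \<in> S \<and> (X has_vector_derivative f (X t)) (at t within {0..})"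
    and t: "0 \<le> t" "t \<le> \<tau>" and n: "\<tau> < real n"
  shows "norm ((\<Phi> (t / real n) ^^ n) (X 0) - X t) \<le> \<tau>\<^sup>2 * (C + L * F) * exp (L * \<tau>) / real n"
proof -
  define h where "h = t / real n"
  have n0: "0 < real n" using n t by linarith
  have h: "0 \<le> h" "h < 1" "real n * h = t" using n t n0 by (auto simp: h_def divide_less_eq)
  have kh: "0 \<le> real (min k n) * h" "real (min k n) * h \<le> \<tau>" for k
  proof -
    show "0 \<le> real (min k n) * h" using h by simp
    have "real (min k n) * h \<le> real n * h" using h by (intro mult_right_mono) auto
    then show "real (min k n) * h \<le> \<tau>" using h t by simp
  qed
  have X0: "X 0 \<in> S" using X[of 0] t by auto
  \<comment> \<open>Past the last grid point the sequence is constant, so that it stays where \<open>X\<close> is controlled.\<close>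
  let ?y = "\<lambda>k. X (real (min k n) * h)"
  have "norm ((\<Phi> h ^^ n) (X 0) - ?y n) \<le> real n * (C * h\<^sup>2 + L * F * h\<^sup>2) * exp (L * (real n * h))"
  proof (rule discrete_gronwall[where f=f and x="\<lambda>k. (\<Phi> h ^^ k) (X 0)" and y="?y"])
    show "norm (f ((\<Phi> h ^^ k) (X 0)) - f (?y k)) \<le> L * norm ((\<Phi> h ^^ k) (X 0) - ?y k)" for k
      by (intro lip iterate_in X0 h conjunct1[OF X] kh)
    show "norm ((\<Phi> h ^^ Suc k) (X 0) - (\<Phi> h ^^ k) (X 0) - h *\<^sub>R f ((\<Phi> h ^^ k) (X 0))) \<le> C * h\<^sup>2" for k
      by (simp, intro consistent iterate_in X0 h)
    show "norm (?y (Suc k) - ?y k - h *\<^sub>R f (?y k)) \<le> L * F * h\<^sup>2" if "k < n" for k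
    proof -
      have "real (min (Suc k) n) * h - real (min k n) * h = h"
        using that by (simp add: min_def algebra_simps)
      moreover have "real (min k n) * h \<le> real (min (Suc k) n) * h"
        using h by (intro mult_right_mono) auto
      ultimately show ?thesis
        using solution_step[OF X kh(1) _ kh(2), of k "Suc k"] by simp
    qed
  qed (use h C0 L0 F0 in auto)
  also have "\<dots> = t\<^sup>2 * (C + L * F) * exp (L * t) / real n"
    using n0 by (simp add: h_def field_simps power2_eq_square)
  also have "\<dots> \<le> \<tau>\<^sup>2 * (C + L * F) * exp (L * \<tau>) / real n"
    using t n0 C0 L0 F0 by (intro divide_right_mono mult_mono power_mono) (auto intro: mult_left_mono)
  finally show ?thesis using h by (simp add: h_def)
qed

lemma iterate_increment:
  assumes a: "a \<in> S" and h: "0 \<le> h" "h < 1"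
  shows "norm ((\<Phi> h ^^ (k + i)) a - (\<Phi> h ^^ k) a) \<le> (F + C) * (real i * h)"
proof (induction i)
  case (Suc i)
  let ?b = "(\<Phi> h ^^ (k + i)) a"
  have b: "?b \<in> S" using a h by (rule iterate_in)
  have "\<Phi> h ?b - ?b = (\<Phi> h ?b - ?b - h *\<^sub>R f ?b) + h *\<^sub>R f ?b" by simp
  also have "norm \<dots> \<le> C * h\<^sup>2 + h * F"
    using consistent[OF h b] bnd[OF b] h by (intro norm_triangle_le add_mono) (auto intro: mult_left_mono)
  also have "C * h\<^sup>2 \<le> C * h" using h C0 by (intro mult_left_mono) (auto simp: power2_eq_square mult_left_le)
  finally have "norm (\<Phi> h ?b - ?b) \<le> (F + C) * h" by (simp add: algebra_simps)
  moreover have "(\<Phi> h ^^ (k + Suc i)) a - (\<Phi> h ^^ k) a = (\<Phi> h ?b - ?b) + (?b - (\<Phi> h ^^ k) a)" by simp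
  ultimately have "norm ((\<Phi> h ^^ (k + Suc i)) a - (\<Phi> h ^^ k) a) \<le> (F + C) * h + (F + C) * (real i * h)"
    using Suc by (metis norm_triangle_mono)
  then show ?case by (simp add: algebra_simps)
qed simp

text \<open>The analogue of \<open>solution_step\<close> for the scheme, over \<open>i\<close> steps. The bound depends on the elapsed time
  \<open>i h\<close> and on an extra term that vanishes with \<open>h\<close>, so that it survives the limit \<open>h \<rightarrow> 0\<close> at
  fixed \<open>i h\<close>; with \<open>i = 2\<close> it says that two half steps are one step up to a quadratic error.\<close>
lemma iterate_expansion:
  assumes a: "a \<in> S" and h: "0 \<le> h" "h < 1"
  shows "norm ((\<Phi> h ^^ (k + i)) a - (\<Phi> h ^^ k) a - (real i * h) *\<^sub>R f ((\<Phi> h ^^ k) a))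
    \<le> C * (real i * h) * h + L * (F + C) * (real i * h)\<^sup>2"
proof (induction i)
  case (Suc i)
  let ?b = "(\<Phi> h ^^ (k + i)) a" and ?c = "(\<Phi> h ^^ k) a"
  have b: "?b \<in> S" and c: "?c \<in> S" using a h by (auto intro: iterate_in)
  have "(\<Phi> h ^^ (k + Suc i)) a - ?c - (real (Suc i) * h) *\<^sub>R f ?c
      = (\<Phi> h ?b - ?b - h *\<^sub>R f ?b) + h *\<^sub>R (f ?b - f ?c) + (?b - ?c - (real i * h) *\<^sub>R f ?c)"
    by (simp add: algebra_simps)
  also have "norm \<dots> \<le> C * h\<^sup>2 + h * (L * ((F + C) * (real i * h)))
      + (C * (real i * h) * h + L * (F + C) * (real i * h)\<^sup>2)"
  proof (intro norm_triangle_le add_mono consistent h b Suc)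
    have "norm (f ?b - f ?c) \<le> L * ((F + C) * (real i * h))"
      using lip[OF b c] iterate_increment[OF a h, of k i] L0 by (meson mult_left_mono order_trans)
    then show "norm (h *\<^sub>R (f ?b - f ?c)) \<le> h * (L * ((F + C) * (real i * h)))"
      using h by (simp add: mult_left_mono)
  qed
  also have "\<dots> = C * (real (Suc i) * h) * h + L * (F + C) * (h\<^sup>2 * (real i + real i * real i))"
    by (simp add: algebra_simps power2_eq_square)
  also have "\<dots> \<le> C * (real (Suc i) * h) * h + L * (F + C) * (real (Suc i) * h)\<^sup>2"
  proof -
    have "h\<^sup>2 * (real i + real i * real i) \<le> h\<^sup>2 * (real (Suc i))\<^sup>2"
      by (intro mult_left_mono) (auto simp: power2_eq_square algebra_simps)
    also have "\<dots> = (real (Suc i) * h)\<^sup>2" by (simp add: power_mult_distrib)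
    finally show ?thesis using L0 F0 C0 by (intro add_left_mono mult_left_mono) auto
  qed
  finally show ?case .
qed simp

lemma dyadic_difference:
  assumes a: "a \<in> S" and h: "0 \<le> h" "h < 1"
  shows "norm ((\<Phi> (h/2) ^^ (2 * k)) a - (\<Phi> h ^^ k) a)
    \<le> real k * (h\<^sup>2 * (C + L * (F + C) + C)) * exp (L * (real k * h))"
proof -
  let ?x = "\<lambda>k. (\<Phi> (h/2) ^^ (2 * k)) a"
  have h2: "0 \<le> h/2" "h/2 < 1" using h by auto
  have "norm (?x k - (\<Phi> h ^^ k) a) \<le> real k * ((C + L * (F + C)) * h\<^sup>2 + C * h\<^sup>2) * exp (L * (real k * h))"
  proof (rule discrete_gronwall[where f=f and x="?x" and y="\<lambda>k. (\<Phi> h ^^ k) a"])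
    show "norm (f (?x k) - f ((\<Phi> h ^^ k) a)) \<le> L * norm (?x k - (\<Phi> h ^^ k) a)" for k
      by (intro lip iterate_in a h h2)
    show "norm ((\<Phi> h ^^ Suc k) a - (\<Phi> h ^^ k) a - h *\<^sub>R f ((\<Phi> h ^^ k) a)) \<le> C * h\<^sup>2" for k
      by (simp, intro consistent iterate_in a h)
    show "norm (?x (Suc k) - ?x k - h *\<^sub>R f (?x k)) \<le> (C + L * (F + C)) * h\<^sup>2" for k
    proof -
      have "norm (?x (Suc k) - ?x k - h *\<^sub>R f (?x k)) \<le> C * h * (h/2) + L * (F + C) * h\<^sup>2"
        using iterate_expansion[OF a h2, of "2 * k" 2] by simp
      also have "\<dots> \<le> (C + L * (F + C)) * h\<^sup>2"
        using C0 h by (simp add: algebra_simps power2_eq_square)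
      finally show ?thesis .
    qed
  qed (use h C0 L0 F0 in auto)
  then show ?thesis by (simp add: algebra_simps)
qed

end

locale closed_one_step_scheme = one_step_scheme S f \<Phi> L F C
  for S :: "'b::banach set" and f \<Phi> L F C +
  assumes closed: "closed S"
begin

text \<open>The solution is the pointwise limit of the step functions \<open>Y j\<close> that follow the scheme with
  step \<open>h j = 2\<^sup>-\<^sup>(\<^sup>j\<^sup>+\<^sup>1\<^sup>)\<close>. Successive ones differ by \<open>O(h j)\<close>, which is summable. Passing to the limit in
  \<open>iterate_expansion\<close> gives the first-order Taylor formula of the limit with a quadratic remainder,
  hence the derivative; pointwise convergence suffices for this.\<close>
lemma ex_solution:
  assumes a: "a \<in> S"
  shows "\<exists>X. X 0 = a \<and> (\<forall>t\<ge>0. X t \<in> S \<and> (X has_vector_derivative f (X t)) (at t within {0..}))"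
proof -
  define h :: "nat \<Rightarrow> real" where "h j = (1/2) ^ Suc j" for j
  define k :: "real \<Rightarrow> nat \<Rightarrow> nat" where "k t j = nat \<lfloor>t / h j\<rfloor>" for t j
  define Y where "Y j t = (\<Phi> (h j) ^^ k t j) a" for j t
  have h: "0 < h j" "h j < 1" "0 \<le> h j" for j
    using power_strict_decreasing[of 0 "Suc j" "1/2::real"] by (auto simp: h_def)
  have hS: "h (Suc j) = h j / 2" for j by (simp add: h_def)
  have h_lim: "h \<longlonglongrightarrow> 0"
    unfolding h_def by (intro LIMSEQ_Suc LIMSEQ_power_zero) simp
  have YS: "Y j t \<in> S" for j t unfolding Y_def by (intro iterate_in a h)
  have kh: "real (k t j) * h j \<le> t" "t < real (k t j) * h j + h j" if "0 \<le> t" for t j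
  proof -
    have "real (k t j) = of_int \<lfloor>t / h j\<rfloor>" using that h[of j] by (simp add: k_def)
    then have "real (k t j) \<le> t / h j" "t / h j < real (k t j) + 1" by linarith+
    then show "real (k t j) * h j \<le> t" "t < real (k t j) * h j + h j"
      using h[of j] by (auto simp: field_simps)
  qed
  have kh_lim: "(\<lambda>j. real (k t j) * h j) \<longlonglongrightarrow> t" if "0 \<le> t" for t
  proof (rule tendsto_sandwich[of "\<lambda>j. t - h j" _ _ "\<lambda>_. t"])
    show "(\<lambda>j. t - h j) \<longlonglongrightarrow> t" using tendsto_diff[OF tendsto_const h_lim, of t] by simp
    show "\<forall>\<^sub>F j in sequentially. t - h j \<le> real (k t j) * h j"
      using kh(2)[OF that] by (intro always_eventually allI) (smt (verit))
  qed (use kh[OF that] in auto)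
  have k_mono: "k s j \<le> k t j" if "s \<le> t" for s t j
    using that h[of j] by (auto simp: k_def intro!: nat_mono floor_mono divide_right_mono)
  have kS: "k t (Suc j) = 2 * k t j \<or> k t (Suc j) = 2 * k t j + 1" if "0 \<le> t" for t j
  proof -
    have "real (k t (Suc j)) * h j \<le> 2 * t" "2 * t < real (k t (Suc j)) * h j + h j"
      using kh[OF that, of "Suc j"] by (auto simp: hS)
    moreover have "real (2 * k t j) * h j \<le> 2 * t" "2 * t < (real (2 * k t j) + 2) * h j"
      using kh[OF that, of j] by (auto simp: algebra_simps)
    ultimately have "real (2 * k t j) * h j < (real (k t (Suc j)) + 1) * h j"
       "real (k t (Suc j)) * h j < (real (2 * k t j) + 2) * h j" by (auto simp: algebra_simps)
    then have "real (2 * k t j) < real (k t (Suc j)) + 1" "real (k t (Suc j)) < real (2 * k t j) + 2"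
      using h[of j] by (auto simp: mult_less_cancel_right)
    then show ?thesis by linarith
  qed
  have conv: "convergent (\<lambda>j. Y j t)" if t: "0 \<le> t" for t
  proof -
    define D where "D = F + C + t * (C + L * (F + C) + C) * exp (L * t)"
    have diff: "norm (Y (Suc j) t - Y j t) \<le> D * h j" for j
    proof -
      have "norm ((\<Phi> (h (Suc j)) ^^ k t (Suc j)) a - (\<Phi> (h (Suc j)) ^^ (2 * k t j)) a) \<le> (F + C) * h j"
      proof -
        obtain i where i: "k t (Suc j) = 2 * k t j + i" "i \<le> 1" using kS[OF t, of j] by force
        have "norm ((\<Phi> (h (Suc j)) ^^ (2 * k t j + i)) a - (\<Phi> (h (Suc j)) ^^ (2 * k t j)) a)
           \<le> (F + C) * (real i * h (Suc j))"
          by (intro iterate_increment a h)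
        also have "\<dots> \<le> (F + C) * h j"
          using i(2) h[of j] F0 C0 by (intro mult_left_mono) (auto simp: hS le_Suc_eq)
        finally show ?thesis using i by simp
      qed
      moreover have "norm ((\<Phi> (h (Suc j)) ^^ (2 * k t j)) a - (\<Phi> (h j) ^^ k t j) a)
          \<le> (t * (C + L * (F + C) + C) * exp (L * t)) * h j"
      proof -
        have "norm ((\<Phi> (h (Suc j)) ^^ (2 * k t j)) a - (\<Phi> (h j) ^^ k t j) a)
          \<le> real (k t j) * ((h j)\<^sup>2 * (C + L * (F + C) + C)) * exp (L * (real (k t j) * h j))"
          unfolding hS by (intro dyadic_difference a h)
        also have "\<dots> = (real (k t j) * h j) * (C + L * (F + C) + C) * exp (L * (real (k t j) * h j)) * h j"
          by (simp add: power2_eq_square)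
        also have "\<dots> \<le> t * (C + L * (F + C) + C) * exp (L * t) * h j"
          using kh[OF t, of j] h[of j] t C0 F0 L0 by (intro mult_mono) (auto intro: mult_left_mono)
        finally show ?thesis .
      qed
      ultimately have "norm (Y (Suc j) t - Y j t) \<le> (F + C) * h j + (t * (C + L * (F + C) + C) * exp (L * t)) * h j"
        unfolding Y_def using norm_triangle_mono by fastforce
      then show ?thesis by (simp add: D_def algebra_simps)
    qed
    have "summable (\<lambda>j. (1/2::real) ^ Suc j)"
      by (subst summable_Suc_iff) (rule summable_geometric, simp)
    then have "summable (\<lambda>j. D * h j)" unfolding h_def by (rule summable_mult)
    then have "summable (\<lambda>j. Y (Suc j) t - Y j t)"
      by (rule summable_comparison_test[rotated]) (use diff in blast)
    then have "convergent (\<lambda>n. \<Sum>j<n. Y (Suc j) t - Y j t)" by (simp add: summable_iff_convergent)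
    then have "convergent (\<lambda>n. Y n t - Y 0 t)"
      by (simp only: sum_lessThan_telescope[of "\<lambda>j. Y j t"])
    from convergent_add[OF this convergent_const[of "Y 0 t"]] show ?thesis by simp
  qed
  define X where "X t = lim (\<lambda>j. Y j t)" for t
  have lim: "(\<lambda>j. Y j t) \<longlonglongrightarrow> X t" if "0 \<le> t" for t
    using conv[OF that] by (simp add: X_def convergent_LIMSEQ_iff)
  have XS: "X t \<in> S" if "0 \<le> t" for t
    using closed_sequentially[OF closed _ lim[OF that]] YS by blast
  have f_lim: "(\<lambda>j. f (Y j t)) \<longlonglongrightarrow> f (X t)" if t: "0 \<le> t" for t
  proof -
    have "(\<lambda>j. L * norm (Y j t - X t)) \<longlonglongrightarrow> 0"
      using lim[OF t] by (intro tendsto_mult_right_zero tendsto_norm_zero) (simp add: LIM_zero)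
    then have "(\<lambda>j. f (Y j t) - f (X t)) \<longlonglongrightarrow> 0"
      by (rule Lim_null_comparison[rotated]) (use lip YS XS[OF t] in auto)
    then show ?thesis by (simp add: LIM_zero_iff)
  qed
  let ?d = "\<lambda>s t j. real (k t j - k s j) * h j"
  have d_lim: "?d s t \<longlonglongrightarrow> t - s" if "0 \<le> s" "s \<le> t" for s t
    using tendsto_diff[OF kh_lim[of t] kh_lim[of s]] that k_mono[OF that(2)]
    by (simp add: of_nat_diff algebra_simps)
  have lipX: "norm (X t - X s) \<le> (F + C) * (t - s)" if st: "0 \<le> s" "s \<le> t" for s t
  proof (rule tendsto_le[OF trivial_limit_sequentially])
    show "(\<lambda>j. (F + C) * ?d s t j) \<longlonglongrightarrow> (F + C) * (t - s)" by (intro tendsto_intros d_lim st)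
    show "(\<lambda>j. norm (Y j t - Y j s)) \<longlonglongrightarrow> norm (X t - X s)" using st by (intro tendsto_intros lim) auto
    show "\<forall>\<^sub>F j in sequentially. norm (Y j t - Y j s) \<le> (F + C) * ?d s t j"
    proof (intro always_eventually allI)
      fix j show "norm (Y j t - Y j s) \<le> (F + C) * ?d s t j"
        using iterate_increment[OF a h(3)[of j] h(2)[of j], of "k s j" "k t j - k s j"] k_mono[OF st(2), of j]
        by (simp add: Y_def)
    qed
  qed
  have expX: "norm (X t - X s - (t - s) *\<^sub>R f (X s)) \<le> L * (F + C) * (t - s)\<^sup>2" if st: "0 \<le> s" "s \<le> t" for s t
  proof (rule tendsto_le[OF trivial_limit_sequentially])
    have "(\<lambda>j. C * ?d s t j * h j + L * (F + C) * (?d s t j)\<^sup>2) \<longlonglongrightarrow> C * (t - s) * 0 + L * (F + C) * (t - s)\<^sup>2"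
      by (intro tendsto_intros d_lim st h_lim)
    then show "(\<lambda>j. C * ?d s t j * h j + L * (F + C) * (?d s t j)\<^sup>2) \<longlonglongrightarrow> L * (F + C) * (t - s)\<^sup>2" by simp
    show "(\<lambda>j. norm (Y j t - Y j s - ?d s t j *\<^sub>R f (Y j s))) \<longlonglongrightarrow> norm (X t - X s - (t - s) *\<^sub>R f (X s))"
      using st by (intro tendsto_intros lim f_lim d_lim) auto
    show "\<forall>\<^sub>F j in sequentially. norm (Y j t - Y j s - ?d s t j *\<^sub>R f (Y j s))
        \<le> C * ?d s t j * h j + L * (F + C) * (?d s t j)\<^sup>2"
    proof (intro always_eventually allI)
      fix j show "norm (Y j t - Y j s - ?d s t j *\<^sub>R f (Y j s))
        \<le> C * ?d s t j * h j + L * (F + C) * (?d s t j)\<^sup>2"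
        using iterate_expansion[OF a h(3)[of j] h(2)[of j], of "k s j" "k t j - k s j"] k_mono[OF st(2), of j]
        by (simp add: Y_def)
    qed
  qed
  \<comment> \<open>Backward in time the expansion starts at \<open>t\<close>; moving its base point to \<open>s\<close> costs a Lipschitz term.\<close>
  have quad: "norm (X t - X s - (t - s) *\<^sub>R f (X s)) \<le> (2 * L * (F + C)) * (t - s)\<^sup>2" if st: "0 \<le> s" "0 \<le> t" for s t
  proof (cases "s \<le> t")
    case True
    have "0 \<le> L * (F + C) * (t - s)\<^sup>2" using L0 F0 C0 by simp
    then show ?thesis using expX[OF st(1) True] by linarith
  next
    case False
    then have ts: "t \<le> s" by simp
    have "X t - X s - (t - s) *\<^sub>R f (X s) = - (X s - X t - (s - t) *\<^sub>R f (X t)) + (s - t) *\<^sub>R (f (X s) - f (X t))"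
      by (simp add: algebra_simps)
    also have "norm \<dots> \<le> L * (F + C) * (s - t)\<^sup>2 + (s - t) * (L * ((F + C) * (s - t)))"
    proof (intro norm_triangle_le add_mono)
      show "norm (- (X s - X t - (s - t) *\<^sub>R f (X t))) \<le> L * (F + C) * (s - t)\<^sup>2"
        using expX[OF st(2) ts] by (simp only: norm_minus_cancel)
      have "norm (f (X s) - f (X t)) \<le> L * ((F + C) * (s - t))"
        using lip[OF XS XS, OF st] lipX[OF st(2) ts] L0 by (meson mult_left_mono order_trans)
      then show "norm ((s - t) *\<^sub>R (f (X s) - f (X t))) \<le> (s - t) * (L * ((F + C) * (s - t)))"
        using ts by (simp add: mult_left_mono)
    qed
    finally show ?thesis by (simp add: algebra_simps power2_eq_square)
  qed
  have "(X has_vector_derivative f (X s)) (at s within {0..})" if s: "0 \<le> s" for s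
    unfolding has_vector_derivative_def has_derivative_within
  proof (intro conjI bounded_linear_scaleR_left)
    show "((\<lambda>t. (1 / norm (t - s)) *\<^sub>R (X t - (X s + (t - s) *\<^sub>R f (X s)))) \<longlongrightarrow> 0) (at s within {0..})"
    proof (rule Lim_null_comparison)
      have "((\<lambda>t. (2 * L * (F + C)) * \<bar>t - s\<bar>) \<longlongrightarrow> (2 * L * (F + C)) * \<bar>s - s\<bar>) (at s within {0..})"
        by (intro tendsto_intros)
      then show "((\<lambda>t. (2 * L * (F + C)) * \<bar>t - s\<bar>) \<longlongrightarrow> 0) (at s within {0..})" by simp
      show "\<forall>\<^sub>F t in at s within {0..}. norm ((1 / norm (t - s)) *\<^sub>R (X t - (X s + (t - s) *\<^sub>R f (X s))))
          \<le> (2 * L * (F + C)) * \<bar>t - s\<bar>"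
        unfolding eventually_at_filter
      proof (intro always_eventually allI impI)
        fix t assume t: "t \<noteq> s" "t \<in> {0..}"
        define Z where "Z = X t - (X s + (t - s) *\<^sub>R f (X s))"
        have "norm Z \<le> (2 * L * (F + C)) * \<bar>t - s\<bar> * \<bar>t - s\<bar>"
          using quad[OF s, of t] t by (simp add: Z_def diff_diff_add power2_eq_square abs_mult_self_eq mult.assoc)
        moreover have "0 < \<bar>t - s\<bar>" using t by simp
        ultimately have "norm ((1 / norm (t - s)) *\<^sub>R Z) \<le> (2 * L * (F + C)) * \<bar>t - s\<bar>"
          by (simp add: pos_divide_le_eq)
        then show "norm ((1 / norm (t - s)) *\<^sub>R (X t - (X s + (t - s) *\<^sub>R f (X s)))) \<le> (2 * L * (F + C)) * \<bar>t - s\<bar>"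
          by (simp only: Z_def)
      qed
    qed
  qed
  moreover have "X 0 = a"
    using LIMSEQ_unique[OF lim[of 0]] by (simp add: Y_def k_def)
  ultimately show ?thesis using XS by blast
qed

end

section \<open>Aluthge transform of a left invertible operator\<close>

text \<open>In terms of the modulus, \<open>m \<le> |A| \<le> M\<close>.\<close>
definition bounded_between :: "real \<Rightarrow> real \<Rightarrow> ('a::complex_inner \<Rightarrow>\<^sub>L 'a) set" where
  "bounded_between m M = {A \<in> bounded_ops. \<forall>x. m * norm x \<le> norm (A x) \<and> norm (A x) \<le> M * norm x}"

definition aluthge_field :: "('a::complex_inner \<Rightarrow>\<^sub>L 'a) \<Rightarrow> 'a \<Rightarrow>\<^sub>L 'a" where
  "aluthge_field A = commutator (cfc ln (op_abs A)) A"

definition abs_powr :: "('a::complex_inner \<Rightarrow>\<^sub>L 'a) \<Rightarrow> real \<Rightarrow> 'a \<Rightarrow>\<^sub>L 'a" where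
  "abs_powr A s = cfc (\<lambda>x. x powr s) (op_abs A)"

lemma closed_bounded_between: "closed (bounded_between m M)"
proof -
  have eq: "bounded_between m M = bounded_ops \<inter>
      (\<Inter>x. {A. m * norm x \<le> norm (blinfun_apply A x)} \<inter> {A. norm (blinfun_apply A x) \<le> M * norm x})"
    by (auto simp: bounded_between_def)
  show ?thesis unfolding eq
    by (intro closed_Int closed_INT ballI closed_bounded_ops closed_Collect_le continuous_intros)
qed

locale modulus_bounds =
  fixes m M :: real
  assumes m0: "0 < m" and mM: "m \<le> M"
begin

definition \<Lambda> :: real where "\<Lambda> = max \<bar>ln m\<bar> \<bar>ln M\<bar>"

definition consistency_constant :: real where
  "consistency_constant = \<Lambda>\<^sup>2 * exp \<Lambda> * M * (1 + \<Lambda> + \<Lambda>\<^sup>2 * exp \<Lambda>) + M * (\<Lambda>\<^sup>2 * exp \<Lambda>) + \<Lambda> * M * (\<Lambda> + \<Lambda>\<^sup>2 * exp \<Lambda>)"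

lemma log_bounds: "0 \<le> \<Lambda>" "x \<in> {m..M} \<Longrightarrow> \<bar>ln x\<bar> \<le> \<Lambda>"
proof -
  show "0 \<le> \<Lambda>" by (simp add: \<Lambda>_def)
  assume "x \<in> {m..M}"
  then have "ln m \<le> ln x" "ln x \<le> ln M" using m0 by auto
  then show "\<bar>ln x\<bar> \<le> \<Lambda>" by (auto simp: \<Lambda>_def)
qed

lemma consistency_constant_nonneg: "0 \<le> consistency_constant"
  using log_bounds(1) m0 mM by (simp add: consistency_constant_def)

context
  fixes A :: "'a::chilbert_space \<Rightarrow>\<^sub>L 'a"
  assumes A: "A \<in> bounded_between m M"
begin

lemma mem_ops: "A \<in> bounded_ops" and norm_lower: "m * norm x \<le> norm (A x)" and norm_upper: "norm (A x) \<le> M * norm x"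
  using A by (auto simp: bounded_between_def)

lemma norm_le_M: "norm A \<le> M"
  by (rule norm_blinfun_bound) (use norm_upper m0 mM in auto)

text \<open>Since \<open>\<langle>A\<^sup>* A x, x\<rangle> = \<parallel>A x\<parallel>\<^sup>2\<close> lies between \<open>m\<^sup>2 \<parallel>x\<parallel>\<^sup>2\<close> and \<open>M\<^sup>2 \<parallel>x\<parallel>\<^sup>2\<close>, one of the operators
  \<open>A\<^sup>* A - c\<close> and \<open>c - A\<^sup>* A\<close> is coercive when \<open>c\<close> is outside of \<open>[m\<^sup>2, M\<^sup>2]\<close>.\<close>
lemma herm_between_square: "herm_between (m\<^sup>2) (M\<^sup>2) (adj A o\<^sub>L A)"
  unfolding herm_between_def
proof (intro conjI herm_adj_compose mem_ops subsetI, rule ccontr)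
  fix c assume c: "c \<in> rspec (adj A o\<^sub>L A)" "c \<notin> {m\<^sup>2..M\<^sup>2}"
  let ?Q = "adj A o\<^sub>L A"
  have Q: "rin (?Q x) x = (norm (A x))\<^sup>2" for x
    using adj_works(2)[OF mem_ops, of x "A x"] by (simp add: rin_self rin_commute)
  have ops: "?Q - c *\<^sub>R id_blinfun \<in> bounded_ops" "c *\<^sub>R id_blinfun - ?Q \<in> bounded_ops"
    by (intro bounded_ops_intros mem_ops adj_works)+
  have "(m * norm x)\<^sup>2 \<le> (norm (A x))\<^sup>2" for x using norm_lower m0 by (intro power_mono) auto
  then have l: "m\<^sup>2 * (norm x)\<^sup>2 \<le> (norm (A x))\<^sup>2" for x by (simp only: power_mult_distrib)
  have "(norm (A x))\<^sup>2 \<le> (M * norm x)\<^sup>2" for x using norm_upper by (intro power_mono) auto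
  then have u: "(norm (A x))\<^sup>2 \<le> M\<^sup>2 * (norm x)\<^sup>2" for x by (simp only: power_mult_distrib)
  have "invertible_op (?Q - c *\<^sub>R id_blinfun)"
  proof (cases "c < m\<^sup>2")
    case True
    show ?thesis
    proof (rule invertible_op_coercive[OF ops(1)])
      show "(m\<^sup>2 - c) * (norm x)\<^sup>2 \<le> rin ((?Q - c *\<^sub>R id_blinfun) x) x" for x
        using l[of x] Q[of x] by (simp add: blinfun.diff_left blinfun.scaleR_left rin.diff_left rin.scaleR_left rin_self algebra_simps)
    qed (use True in simp)
  next
    case False
    then have "M\<^sup>2 < c" using c(2) by auto
    have "invertible_op (c *\<^sub>R id_blinfun - ?Q)"
    proof (rule invertible_op_coercive[OF ops(2)])
      show "(c - M\<^sup>2) * (norm x)\<^sup>2 \<le> rin ((c *\<^sub>R id_blinfun - ?Q) x) x" for x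
        using u[of x] Q[of x] by (simp add: blinfun.diff_left blinfun.scaleR_left rin.diff_left rin.scaleR_left rin_self algebra_simps)
    qed (use \<open>M\<^sup>2 < c\<close> in simp)
    from invertible_op_scaleR[OF this, of "-1"] show ?thesis by simp
  qed
  then show False using c(1) by (simp add: rspec_iff)
qed

lemma sqrt_image: "sqrt ` {m\<^sup>2..M\<^sup>2} \<subseteq> {m..M}"
proof (rule image_subsetI)
  fix x assume "x \<in> {m\<^sup>2..M\<^sup>2}"
  then have "m \<le> sqrt x" "sqrt x \<le> sqrt (M\<^sup>2)"
    by (auto intro: real_le_rsqrt simp only: atLeastAtMost_iff real_sqrt_le_iff)
  then show "sqrt x \<in> {m..M}" using m0 mM by simp
qed

lemma sqrt_cont: "continuous_on {m\<^sup>2..M\<^sup>2} sqrt"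
  by (intro continuous_intros)

lemma herm_between_abs: "herm_between m M (op_abs A)"
  unfolding op_abs_def by (rule herm_between_cfc[OF herm_between_square sqrt_cont sqrt_image])

lemma abs_square: "op_abs A o\<^sub>L op_abs A = adj A o\<^sub>L A"
proof -
  have "cfc (\<lambda>x. sqrt x * sqrt x) (adj A o\<^sub>L A) = cfc (\<lambda>x. x) (adj A o\<^sub>L A)"
  proof (rule cfc_cong[OF herm_between_square])
    fix x assume "x \<in> {m\<^sup>2..M\<^sup>2}"
    then have "0 \<le> x" using zero_le_power2[of m] by (meson atLeastAtMost_iff order_trans)
    then show "sqrt x * sqrt x = x" by simp
  qed (intro continuous_intros)
  then show ?thesis
    unfolding op_abs_def cfc_mult[OF herm_between_square sqrt_cont sqrt_cont] cfc_ident[OF herm_between_square] .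
qed

lemma norm_abs_apply: "norm (op_abs A x) = norm (A x)"
proof -
  have "(norm (op_abs A x))\<^sup>2 = rin ((op_abs A o\<^sub>L op_abs A) x) x"
    using hermD(2)[OF herm_betweenD(1)[OF herm_between_abs], of "op_abs A x" x] by (simp add: rin_self)
  also have "\<dots> = (norm (A x))\<^sup>2"
    unfolding abs_square using adj_works(2)[OF mem_ops, of x "A x"] by (simp add: rin_self rin_commute)
  finally show ?thesis by simp
qed

lemma powr_cont: "continuous_on {m..M} (\<lambda>x. x powr s)"
  using m0 by (intro continuous_intros) auto

lemma ln_cont: "continuous_on {m..M} ln"
  using m0 by (intro continuous_intros) auto

lemma abs_powr_add: "abs_powr A s o\<^sub>L abs_powr A t = abs_powr A (s + t)"
  unfolding abs_powr_def powr_add by (rule cfc_mult[OF herm_between_abs powr_cont powr_cont, symmetric])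

lemma abs_powr_0: "abs_powr A 0 = id_blinfun"
  using cfc_cong[OF herm_between_abs continuous_on_const[of _ 1], of "\<lambda>x. x powr 0"]
    cfc_const[OF herm_between_abs, of 1] m0 by (simp add: abs_powr_def)

lemma abs_powr_1: "abs_powr A 1 = op_abs A"
  using cfc_cong[OF herm_between_abs continuous_on_id[unfolded id_def], of "\<lambda>x. x powr 1"]
    cfc_ident[OF herm_between_abs] m0 by (simp add: abs_powr_def)

lemma abs_powr_ops: "abs_powr A s \<in> bounded_ops"
  unfolding abs_powr_def by (rule hermD(1)[OF herm_cfc[OF herm_between_abs powr_cont]])

lemma norm_abs_powr_le:
  assumes "0 \<le> s" shows "norm (abs_powr A s) \<le> M powr s" "norm (abs_powr A (- s)) \<le> m powr (- s)"
proof -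
  show "norm (abs_powr A s) \<le> M powr s"
    unfolding abs_powr_def by (rule norm_cfc_le[OF herm_between_abs powr_cont]) (use m0 assms in \<open>auto intro: powr_mono2\<close>)
  show "norm (abs_powr A (- s)) \<le> m powr (- s)"
    unfolding abs_powr_def by (rule norm_cfc_le[OF herm_between_abs powr_cont]) (use m0 assms in \<open>auto intro: powr_mono2'\<close>)
qed

lemma abs_powr_bounds:
  assumes "0 \<le> s"
  shows "m powr s * norm x \<le> norm (abs_powr A s x)" "norm (abs_powr A s x) \<le> M powr s * norm x"
proof -
  show "norm (abs_powr A s x) \<le> M powr s * norm x"
    using norm_blinfun[of "abs_powr A s" x] mult_right_mono[OF norm_abs_powr_le(1)[OF assms], of "norm x"] by simp
  have "abs_powr A (- s) (abs_powr A s x) = x"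
    using abs_powr_add[of "- s" s] abs_powr_0 by (metis add.left_inverse blinfun_apply_blinfun_compose blinfun_apply_id_blinfun)
  then have "norm x \<le> norm (abs_powr A (- s)) * norm (abs_powr A s x)" by (metis norm_blinfun)
  also have "\<dots> \<le> m powr (- s) * norm (abs_powr A s x)"
    by (intro mult_right_mono norm_abs_powr_le assms) simp
  finally have "m powr s * norm x \<le> m powr s * (m powr (- s) * norm (abs_powr A s x))"
    by (rule mult_left_mono) simp
  also have "\<dots> = norm (abs_powr A s x)" using m0 by (simp add: powr_minus field_simps)
  finally show "m powr s * norm x \<le> norm (abs_powr A s x)" .
qed

lemma apply_eq_0_iff: "A x = 0 \<longleftrightarrow> x = 0"
  using norm_lower[of x] m0 by (auto simp: mult_le_0_iff)

text \<open>An invertible modulus can be cancelled from the right, so the polar part is unique; and \<open>A |A|\<^sup>-\<^sup>1\<close>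
  is isometric because \<open>\<parallel>A y\<parallel> = \<parallel>|A| y\<parallel>\<close>.\<close>
lemma polar_part_eq: "polar_part A = A o\<^sub>L abs_powr A (-1)"
proof -
  let ?U = "A o\<^sub>L abs_powr A (-1)"
  have inv: "abs_powr A (-1) o\<^sub>L op_abs A = id_blinfun" "op_abs A o\<^sub>L abs_powr A (-1) = id_blinfun"
    using abs_powr_add[of "-1" 1] abs_powr_add[of 1 "-1"] abs_powr_0 abs_powr_1 by simp_all
  have iso: "norm (?U x) = norm x" for x
  proof -
    have "norm (?U x) = norm ((op_abs A o\<^sub>L abs_powr A (-1)) x)" by (simp add: norm_abs_apply)
    then show ?thesis by (simp only: inv blinfun_apply_id_blinfun)
  qed
  show ?thesis unfolding polar_part_def
  proof (rule the_equality)
    have "partial_isometry ?U"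
      unfolding partial_isometry_def using iso by (auto intro: bounded_ops_intros mem_ops abs_powr_ops)
    moreover have "A = ?U o\<^sub>L op_abs A" by (simp add: blinfun_compose_simps inv)
    moreover have "?U x = 0 \<longleftrightarrow> A x = 0" for x using iso[of x] apply_eq_0_iff[of x] by (metis norm_eq_zero)
    ultimately show "partial_isometry ?U \<and> A = ?U o\<^sub>L op_abs A \<and> (\<forall>x. ?U x = 0 \<longleftrightarrow> A x = 0)" by blast
  next
    fix U assume "partial_isometry U \<and> A = U o\<^sub>L op_abs A \<and> (\<forall>x. U x = 0 \<longleftrightarrow> A x = 0)"
    then have "?U = (U o\<^sub>L op_abs A) o\<^sub>L abs_powr A (-1)" by simp
    also have "\<dots> = U" by (simp add: blinfun_compose_simps inv)
    finally show "U = ?U" by simp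
  qed
qed

text \<open>The inverse modulus in the polar part is absorbed by the right factor \<open>|A|\<^sup>1\<^sup>-\<^sup>l\<close>. The
  special case \<open>l = 0\<close> in the definition of the transform agrees with the formula.\<close>
lemma aluthge_eq_conjugation: "aluthge l A = abs_powr A l o\<^sub>L A o\<^sub>L abs_powr A (- l)"
proof (cases "l = 0")
  case True then show ?thesis by (simp add: aluthge_def abs_powr_0 blinfun_compose_simps)
next
  case False
  have "abs_powr A (-1) o\<^sub>L abs_powr A (1 - l) = abs_powr A (- l)" by (simp add: abs_powr_add)
  then show ?thesis using False
    unfolding aluthge_def polar_part_eq abs_powr_def[symmetric] by (simp add: blinfun_compose_simps)
qed

text \<open>Because \<open>\<parallel>A y\<parallel> = \<parallel>|A| y\<parallel>\<close>, the norm of the transform at \<open>x\<close> is that of \<open>|A|\<^sup>l\<close> applied to a vector of the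
  same length as \<open>|A|\<^sup>1\<^sup>-\<^sup>l x\<close>, and the bounds of the two powers multiply to \<open>m\<close> and \<open>M\<close>.\<close>
lemma aluthge_in:
  assumes l: "0 \<le> l" "l \<le> 1" shows "aluthge l A \<in> bounded_between m M"
proof -
  have "abs_powr A 1 o\<^sub>L abs_powr A (- l) = abs_powr A (1 - l)" by (simp add: abs_powr_add)
  then have n: "norm (A (abs_powr A (- l) x)) = norm (abs_powr A (1 - l) x)" for x
    by (metis norm_abs_apply abs_powr_1 blinfun_apply_blinfun_compose)
  have ap: "aluthge l A x = abs_powr A l (A (abs_powr A (- l) x))" for x by (simp add: aluthge_eq_conjugation)
  have M0: "0 < M" using m0 mM by simp
  have p: "m powr l * m powr (1 - l) = m" "M powr l * M powr (1 - l) = M"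
    using m0 M0 by (simp_all add: powr_add[symmetric])
  have "aluthge l A \<in> bounded_ops"
    unfolding aluthge_eq_conjugation by (intro bounded_ops_intros mem_ops abs_powr_ops)
  moreover have "m * norm x \<le> norm (aluthge l A x)" for x
  proof -
    have "m powr l * (m powr (1 - l) * norm x) \<le> m powr l * norm (abs_powr A (1 - l) x)"
      using l by (intro mult_left_mono abs_powr_bounds) auto
    also have "\<dots> \<le> norm (aluthge l A x)"
      unfolding ap n[symmetric] by (rule abs_powr_bounds(1)[OF l(1)])
    finally show ?thesis by (simp add: mult.assoc[symmetric] p)
  qed
  moreover have "norm (aluthge l A x) \<le> M * norm x" for x
  proof -
    have "norm (aluthge l A x) \<le> M powr l * norm (abs_powr A (1 - l) x)"
      unfolding ap n[symmetric] by (rule abs_powr_bounds(2)[OF l(1)])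
    also have "\<dots> \<le> M powr l * (M powr (1 - l) * norm x)"
      using l by (intro mult_left_mono abs_powr_bounds) auto
    finally show ?thesis by (simp add: mult.assoc[symmetric] p)
  qed
  ultimately show ?thesis by (simp add: bounded_between_def)
qed

lemma mem_left_invertible: "left_invertible A"
proof -
  have "op_abs A o\<^sub>L abs_powr A (-1) = id_blinfun" "abs_powr A (-1) o\<^sub>L op_abs A = id_blinfun"
    using abs_powr_add[of "-1" 1] abs_powr_add[of 1 "-1"] abs_powr_0 abs_powr_1 by simp_all
  then have "(abs_powr A (-1) o\<^sub>L abs_powr A (-1)) o\<^sub>L (op_abs A o\<^sub>L op_abs A) = id_blinfun"
    by (metis blinfun_compose_simps(7,9))
  then have "(abs_powr A (-1) o\<^sub>L abs_powr A (-1) o\<^sub>L adj A) o\<^sub>L A = id_blinfun"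
    by (simp add: abs_square blinfun_compose_simps)
  moreover have "abs_powr A (-1) o\<^sub>L abs_powr A (-1) o\<^sub>L adj A \<in> bounded_ops"
    by (intro bounded_ops_intros abs_powr_ops adj_works mem_ops)
  ultimately show ?thesis using mem_ops unfolding left_invertible_def by blast
qed

text \<open>This removes the square root from the vector field, so that only the logarithm has to be shown
  Lipschitz.\<close>
lemma ln_abs_eq: "cfc ln (op_abs A) = (1/2) *\<^sub>R cfc ln (adj A o\<^sub>L A)"
proof -
  have pos: "0 < x" if "x \<in> {m\<^sup>2..M\<^sup>2}" for x
    using that m0 by (meson atLeastAtMost_iff less_le_trans zero_less_power)
  have c: "continuous_on {m\<^sup>2..M\<^sup>2} ln" using pos by (intro continuous_intros) force
  have "cfc ln (op_abs A) = cfc (\<lambda>x. ln (sqrt x)) (adj A o\<^sub>L A)"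
    unfolding op_abs_def by (rule cfc_compose[OF herm_between_square sqrt_cont sqrt_image ln_cont])
  also have "\<dots> = cfc (\<lambda>x. (1/2) * ln x) (adj A o\<^sub>L A)"
  proof (rule cfc_cong[OF herm_between_square continuous_on_mult_left[OF c]])
    show "ln (sqrt x) = (1/2) * ln x" if "x \<in> {m\<^sup>2..M\<^sup>2}" for x
      using ln_sqrt[OF less_imp_le[OF pos[OF that]]] by simp
  qed
  also have "\<dots> = (1/2) *\<^sub>R cfc ln (adj A o\<^sub>L A)" by (rule cfc_scaleR[OF herm_between_square c])
  finally show ?thesis .
qed

lemma norm_ln_abs: "norm (cfc ln (op_abs A)) \<le> \<Lambda>"
  by (rule norm_cfc_le[OF herm_between_abs ln_cont log_bounds])

lemma norm_aluthge_field: "norm (aluthge_field A) \<le> 2 * \<Lambda> * M"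
proof -
  have "norm (aluthge_field A) \<le> \<Lambda> * M + M * \<Lambda>"
    unfolding aluthge_field_def commutator_def
    by (intro norm_triangle_le_diff add_mono order_trans[OF norm_blinfun_compose] mult_mono norm_ln_abs norm_le_M log_bounds)
      (use m0 mM in auto)
  then show ?thesis by (simp add: mult_ac)
qed

lemma powr_expansion:
  fixes x s :: real
  assumes x: "x \<in> {m..M}" and s: "\<bar>s\<bar> \<le> 1"
  shows "\<bar>x powr s - 1 - s * ln x\<bar> \<le> \<Lambda>\<^sup>2 * exp \<Lambda> * s\<^sup>2"
proof -
  let ?u = "s * ln x"
  have "\<bar>?u\<bar> \<le> 1 * \<Lambda>" unfolding abs_mult using s log_bounds(2)[OF x] by (intro mult_mono) auto
  then have u: "\<bar>?u\<bar> \<le> \<Lambda>" by simp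
  obtain t where t: "\<bar>t\<bar> \<le> \<bar>?u\<bar>" "exp ?u = (\<Sum>k<2. ?u ^ k / fact k) + exp t / fact 2 * ?u ^ 2"
    using Maclaurin_exp_le by blast
  have "x powr s = exp ?u" using x m0 by (simp add: powr_def)
  moreover have "(\<Sum>k<2. ?u ^ k / fact k) = 1 + ?u" by (simp add: lessThan_Suc numeral_2_eq_2)
  ultimately have "x powr s - 1 - ?u = exp t / 2 * (s\<^sup>2 * (ln x)\<^sup>2)"
    using t(2) by (simp add: power_mult_distrib)
  then have "\<bar>x powr s - 1 - ?u\<bar> = (exp t / 2) * (s\<^sup>2 * (ln x)\<^sup>2)" by (simp only:) simp
  also have "\<dots> \<le> exp \<Lambda> * (s\<^sup>2 * \<Lambda>\<^sup>2)"
  proof (intro mult_mono)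
    have "exp t \<le> exp \<Lambda>" using t(1) u by simp
    then show "exp t / 2 \<le> exp \<Lambda>" by (smt (verit) exp_gt_zero field_sum_of_halves)
    show "(ln x)\<^sup>2 \<le> \<Lambda>\<^sup>2" using power_mono[OF log_bounds(2)[OF x], of 2] by simp
  qed auto
  finally show ?thesis by (simp add: mult_ac)
qed

lemma abs_powr_expansion:
  assumes "\<bar>s\<bar> \<le> 1"
  shows "norm (abs_powr A s - id_blinfun - s *\<^sub>R cfc ln (op_abs A)) \<le> \<Lambda>\<^sup>2 * exp \<Lambda> * s\<^sup>2"
proof -
  have "norm (cfc (\<lambda>x. x powr s - 1 - s * ln x) (op_abs A)) \<le> \<Lambda>\<^sup>2 * exp \<Lambda> * s\<^sup>2"
    by (rule norm_cfc_le[OF herm_between_abs])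
      (use powr_expansion assms in \<open>auto intro!: continuous_intros powr_cont ln_cont\<close>)
  moreover have "cfc (\<lambda>x. x powr s - 1 - s * ln x) (op_abs A) = abs_powr A s - id_blinfun - s *\<^sub>R cfc ln (op_abs A)"
    unfolding abs_powr_def
    by (simp add: cfc_diff[OF herm_between_abs] cfc_const[OF herm_between_abs] cfc_scaleR[OF herm_between_abs ln_cont]
        powr_cont ln_cont continuous_on_diff continuous_on_mult_left)
  ultimately show ?thesis by simp
qed

text \<open>With \<open>L = log |A|\<close> and the Taylor remainders \<open>E\<close> and \<open>G\<close> of \<open>|A|\<^sup>l\<close> and \<open>|A|\<^sup>-\<^sup>l\<close>, the error of the
  conjugation is \<open>E A |A|\<^sup>-\<^sup>l + A G + l L A (|A|\<^sup>-\<^sup>l - 1)\<close>, and each summand is \<open>O(l\<^sup>2)\<close>.\<close>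
lemma aluthge_expansion:
  assumes l: "0 \<le> l" "l \<le> 1"
  shows "norm (aluthge l A - A - l *\<^sub>R aluthge_field A) \<le> consistency_constant * l\<^sup>2"
proof -
  let ?L = "cfc ln (op_abs A)" and ?K = "\<Lambda>\<^sup>2 * exp \<Lambda>"
  define D where "D = abs_powr A (- l) - id_blinfun"
  define E where "E = abs_powr A l - id_blinfun - l *\<^sub>R ?L"
  define G where "G = abs_powr A (- l) - id_blinfun + l *\<^sub>R ?L"
  have K0: "0 \<le> ?K" by simp
  have M0: "0 \<le> M" using m0 mM by simp
  have E: "norm E \<le> ?K * l\<^sup>2" using abs_powr_expansion[of l] l by (simp add: E_def)
  have G: "norm G \<le> ?K * l\<^sup>2" using abs_powr_expansion[of "- l"] l by (simp add: G_def)
  have "norm D = norm (G - l *\<^sub>R ?L)" by (simp add: D_def G_def)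
  also have "\<dots> \<le> ?K * l\<^sup>2 + l * \<Lambda>"
    using G norm_ln_abs l by (intro norm_triangle_le_diff add_mono) (auto intro: mult_left_mono)
  also have "?K * l\<^sup>2 \<le> ?K * l" using l K0 by (intro mult_left_mono) (auto simp: power2_eq_square mult_left_le)
  finally have D: "norm D \<le> (\<Lambda> + ?K) * l" by (simp add: algebra_simps)
  have "(\<Lambda> + ?K) * l \<le> \<Lambda> + ?K" using l K0 log_bounds(1) by (simp add: mult_left_le)
  moreover have "norm (abs_powr A (- l)) \<le> norm (id_blinfun :: 'a \<Rightarrow>\<^sub>L 'a) + norm D"
    using norm_triangle_ineq[of "id_blinfun :: 'a \<Rightarrow>\<^sub>L 'a" D] by (simp add: D_def)
  moreover have "norm (id_blinfun :: 'a \<Rightarrow>\<^sub>L 'a) \<le> 1" by (rule norm_blinfun_id_le)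
  ultimately have W: "norm (abs_powr A (- l)) \<le> 1 + \<Lambda> + ?K" using D by linarith
  have "aluthge l A - A - l *\<^sub>R aluthge_field A
     = (E o\<^sub>L (A o\<^sub>L abs_powr A (- l))) + (A o\<^sub>L G) + l *\<^sub>R (?L o\<^sub>L (A o\<^sub>L D))"
    by (simp add: aluthge_eq_conjugation aluthge_field_def commutator_def D_def E_def G_def
        blinfun_compose_simps scaleR_diff_right)
  also have "norm \<dots> \<le> ?K * l\<^sup>2 * (M * (1 + \<Lambda> + ?K)) + M * (?K * l\<^sup>2) + l * (\<Lambda> * (M * ((\<Lambda> + ?K) * l)))"
  proof (intro norm_triangle_le add_mono)
    show "norm (E o\<^sub>L (A o\<^sub>L abs_powr A (- l))) \<le> ?K * l\<^sup>2 * (M * (1 + \<Lambda> + ?K))"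
      using K0 M0 by (intro order_trans[OF norm_blinfun_compose] mult_mono E norm_le_M W) auto
    show "norm (A o\<^sub>L G) \<le> M * (?K * l\<^sup>2)"
      using M0 by (intro order_trans[OF norm_blinfun_compose] mult_mono norm_le_M G) auto
    have "norm (?L o\<^sub>L (A o\<^sub>L D)) \<le> \<Lambda> * (M * ((\<Lambda> + ?K) * l))"
      using M0 log_bounds(1) by (intro order_trans[OF norm_blinfun_compose] mult_mono norm_ln_abs norm_le_M D) auto
    then show "norm (l *\<^sub>R (?L o\<^sub>L (A o\<^sub>L D))) \<le> l * (\<Lambda> * (M * ((\<Lambda> + ?K) * l)))"
      using l by (simp add: mult_left_mono)
  qed
  also have "\<dots> = consistency_constant * l\<^sup>2"
    by (simp add: consistency_constant_def algebra_simps power2_eq_square)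
  finally show ?thesis .
qed

end

lemma norm_ln_abs_diff:
  fixes A B :: "'a::chilbert_space \<Rightarrow>\<^sub>L 'a"
  assumes A: "A \<in> bounded_between m M" and B: "B \<in> bounded_between m M"
  shows "norm (cfc ln (op_abs A) - cfc ln (op_abs B)) \<le> M / m\<^sup>2 * norm (A - B)"
proof -
  have M0: "0 \<le> M" using m0 mM by simp
  note ops = mem_ops[OF A] mem_ops[OF B]
  have "(adj A o\<^sub>L A) - (adj B o\<^sub>L B) = (adj A o\<^sub>L (A - B)) + (adj (A - B) o\<^sub>L B)"
    by (simp add: adj_diff[OF ops] blinfun_compose_simps)
  also have "norm \<dots> \<le> M * norm (A - B) + norm (A - B) * M"
    using M0 norm_le_M[OF B] order_trans[OF norm_adj_le[OF ops(1)] norm_le_M[OF A]]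
      norm_adj_le[OF bounded_ops_intros(4)[OF ops]]
    by (intro norm_triangle_le add_mono order_trans[OF norm_blinfun_compose] mult_mono) auto
  finally have Q: "norm ((adj A o\<^sub>L A) - (adj B o\<^sub>L B)) \<le> 2 * M * norm (A - B)" by (simp add: mult_ac)
  have "norm (cfc ln (op_abs A) - cfc ln (op_abs B))
      = (1/2) * norm (cfc ln (adj A o\<^sub>L A) - cfc ln (adj B o\<^sub>L B))"
    by (simp add: ln_abs_eq[OF A] ln_abs_eq[OF B] scaleR_diff_right[symmetric])
  also have "\<dots> \<le> (1/2) * (norm ((adj A o\<^sub>L A) - (adj B o\<^sub>L B)) / m\<^sup>2)"
    using m0 mM by (intro mult_left_mono cfc_ln_lipschitz[OF herm_between_square[OF A] herm_between_square[OF B]])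
      (auto intro: power_mono)
  also have "\<dots> \<le> (1/2) * (2 * M * norm (A - B) / m\<^sup>2)"
    by (intro mult_left_mono divide_right_mono Q) auto
  finally show ?thesis by simp
qed

definition lipschitz_constant :: real where
  "lipschitz_constant = 2 * (M\<^sup>2 / m\<^sup>2 + \<Lambda>)"

lemma aluthge_field_lipschitz:
  fixes A B :: "'a::chilbert_space \<Rightarrow>\<^sub>L 'a"
  assumes A: "A \<in> bounded_between m M" and B: "B \<in> bounded_between m M"
  shows "norm (aluthge_field A - aluthge_field B) \<le> lipschitz_constant * norm (A - B)"
proof -
  let ?L = "\<lambda>A. cfc ln (op_abs A)" and ?d = "norm (A - B)"
  have M0: "0 \<le> M" using m0 mM by simp
  have tri: "norm (p + q - u - v) \<le> norm p + norm q + norm u + norm v" for p q u v :: "'a \<Rightarrow>\<^sub>L 'a"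
    using norm_triangle_ineq4[of "p + q - u" v] norm_triangle_ineq4[of "p + q" u] norm_triangle_ineq[of p q]
    by linarith
  have "aluthge_field A - aluthge_field B
     = ((?L A - ?L B) o\<^sub>L A) + (?L B o\<^sub>L (A - B)) - ((A - B) o\<^sub>L ?L A) - (B o\<^sub>L (?L A - ?L B))"
    by (simp add: aluthge_field_def commutator_def blinfun_compose_simps)
  also have "norm \<dots> \<le> M / m\<^sup>2 * ?d * M + \<Lambda> * ?d + ?d * \<Lambda> + M * (M / m\<^sup>2 * ?d)"
    by (intro order_trans[OF tri] add_mono order_trans[OF norm_blinfun_compose] mult_mono
        norm_ln_abs_diff A B norm_le_M norm_ln_abs order_refl) (use M0 log_bounds(1) in auto)
  also have "\<dots> = lipschitz_constant * ?d"
    by (simp add: lipschitz_constant_def algebra_simps power2_eq_square add_divide_distrib)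
  finally show ?thesis .
qed

lemma aluthge_scheme:
  "closed_one_step_scheme (bounded_between m M :: ('a::chilbert_space \<Rightarrow>\<^sub>L 'a) set) aluthge_field aluthge
     lipschitz_constant (2 * \<Lambda> * M) consistency_constant"
proof
  show "0 \<le> lipschitz_constant" "0 \<le> 2 * \<Lambda> * M"
    using log_bounds(1) m0 mM by (simp_all add: lipschitz_constant_def)
qed (auto intro: aluthge_field_lipschitz norm_aluthge_field aluthge_in aluthge_expansion
    consistency_constant_nonneg closed_bounded_between)

end

section \<open>Aluthge flow\<close>

lemma left_invertible_bounded_below:
  fixes A :: "'a::chilbert_space \<Rightarrow>\<^sub>L 'a"
  assumes "left_invertible A"
  shows "A \<in> bounded_ops" "\<exists>m>0. \<forall>x. m * norm x \<le> norm (A x)"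
proof -
  show "A \<in> bounded_ops" using assms by (simp add: left_invertible_def)
  obtain B where B: "B o\<^sub>L A = id_blinfun" using assms by (auto simp: left_invertible_def)
  have K: "0 < norm B + 1" by (simp add: add_nonneg_pos)
  have "1 / (norm B + 1) * norm x \<le> norm (A x)" for x
  proof -
    have "norm x = norm (B (A x))" using arg_cong[OF B, of "\<lambda>F. blinfun_apply F x"] by simp
    also have "\<dots> \<le> norm B * norm (A x)" by (rule norm_blinfun)
    also have "\<dots> \<le> (norm B + 1) * norm (A x)" by (intro mult_right_mono) auto
    finally show ?thesis using K by (simp add: pos_divide_le_eq mult.commute)
  qed
  then show "\<exists>m>0. \<forall>x. m * norm x \<le> norm (A x)" using K by (intro exI[of _ "1 / (norm B + 1)"]) simp
qed

text \<open>A lower bound \<open>\<mu>\<close> of \<open>A\<close> persists as \<open>\<mu> / 2\<close> for operators within distance \<open>\<mu> / 2\<close>, so a finite subcover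
  by such balls yields a common bound.\<close>
lemma compact_left_invertible_bounded_between:
  fixes K :: "('a::chilbert_space \<Rightarrow>\<^sub>L 'a) set"
  assumes K: "compact K" and inv: "\<And>A. A \<in> K \<Longrightarrow> left_invertible A"
  obtains m M where "modulus_bounds m M" "K \<subseteq> bounded_between m M"
proof -
  have "\<forall>A\<in>K. \<exists>m>0. \<forall>x. m * norm x \<le> norm (A x)" using left_invertible_bounded_below(2)[OF inv] by blast
  then obtain \<mu> where \<mu>: "\<And>A. A \<in> K \<Longrightarrow> 0 < \<mu> A" "\<And>A x. A \<in> K \<Longrightarrow> \<mu> A * norm x \<le> norm (A x)"
    by metis
  have "K \<subseteq> (\<Union>A\<in>K. ball A (\<mu> A / 2))" using \<mu>(1) by force
  from compactE_image[OF K _ this] obtain D where D: "D \<subseteq> K" "finite D" "K \<subseteq> (\<Union>A\<in>D. ball A (\<mu> A / 2))"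
    by auto
  define m where "m = Min (insert 1 ((\<lambda>A. \<mu> A / 2) ` D))"
  have m0: "0 < m" unfolding m_def by (subst Min_gr_iff) (use D \<mu>(1) in auto)
  have m_le: "m \<le> \<mu> A / 2" if "A \<in> D" for A unfolding m_def by (rule Min_le) (use D that in auto)
  obtain b where b: "\<And>A. A \<in> K \<Longrightarrow> norm A \<le> b" using compact_imp_bounded[OF K] by (auto simp: bounded_iff)
  have "K \<subseteq> bounded_between m (max m b)"
  proof
    fix B assume B: "B \<in> K"
    then obtain A where A: "A \<in> D" "norm (A - B) < \<mu> A / 2" using D(3) by (force simp: dist_norm)
    have "m * norm x \<le> norm (B x)" for x
    proof -
      have "\<mu> A * norm x \<le> norm (A x)" using A(1) D(1) by (intro \<mu>(2)) auto
      also have "A x = B x + (A - B) x" by (simp add: blinfun.diff_left)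
      also have "norm \<dots> \<le> norm (B x) + norm (A - B) * norm x" by (intro norm_triangle_le add_left_mono norm_blinfun)
      also have "norm (A - B) * norm x \<le> \<mu> A / 2 * norm x" using A(2) by (intro mult_right_mono) auto
      finally have "\<mu> A / 2 * norm x \<le> norm (B x)" by (simp add: algebra_simps)
      moreover have "m * norm x \<le> \<mu> A / 2 * norm x" by (intro mult_right_mono m_le A) simp
      ultimately show ?thesis by linarith
    qed
    moreover have "norm (B x) \<le> max m b * norm x" for x
      using b[OF B] by (intro order_trans[OF norm_blinfun] mult_right_mono) auto
    ultimately show "B \<in> bounded_between m (max m b)"
      using left_invertible_bounded_below(1)[OF inv[OF B]] by (simp add: bounded_between_def)
  qed
  moreover have "modulus_bounds m (max m b)" using m0 by unfold_locales auto
  ultimately show ?thesis by (rule that[rotated])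
qed

lemma aluthge_solution_exists:
  fixes T :: "'a::chilbert_space \<Rightarrow>\<^sub>L 'a"
  assumes "left_invertible T"
  obtains X where "aluthge_solution T X"
proof -
  obtain m M where bd: "modulus_bounds m M" "{T} \<subseteq> bounded_between m M"
    using compact_left_invertible_bounded_between[of "{T}"] assms by auto
  interpret modulus_bounds m M by fact
  interpret closed_one_step_scheme "bounded_between m M :: ('a \<Rightarrow>\<^sub>L 'a) set" aluthge_field aluthge
    lipschitz_constant "2 * \<Lambda> * M" consistency_constant by (rule aluthge_scheme)
  obtain X where "X 0 = T" "\<And>t. 0 \<le> t \<Longrightarrow> X t \<in> bounded_between m M"
      "\<And>t. 0 \<le> t \<Longrightarrow> (X has_vector_derivative aluthge_field (X t)) (at t within {0..})"
    using ex_solution[of T] bd(2) by blast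
  then have "aluthge_solution T X"
    unfolding aluthge_solution_def by (auto simp: aluthge_field_def intro: mem_left_invertible)
  then show ?thesis by (rule that)
qed

text \<open>The solution is an arbitrary one, not the limit constructed before. On a compact
  time interval its trajectory is compact and thus lies in a set where the scheme applies, although
  possibly with worse bounds than those of \<open>T\<close>.\<close>
lemma aluthge_iterates_converge:
  fixes T :: "'a::chilbert_space \<Rightarrow>\<^sub>L 'a"
  assumes X: "aluthge_solution T X" and \<tau>: "0 \<le> \<tau>"
  obtains D where "\<And>n t. \<tau> < real n \<Longrightarrow> 0 \<le> t \<Longrightarrow> t \<le> \<tau> \<Longrightarrow> norm ((aluthge (t / real n) ^^ n) T - X t) \<le> D / real n"
proof -
  have X0: "X 0 = T" and inv: "\<And>t. 0 \<le> t \<Longrightarrow> left_invertible (X t)"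
    and der: "\<And>t. 0 \<le> t \<Longrightarrow> (X has_vector_derivative aluthge_field (X t)) (at t within {0..})"
    using X by (auto simp: aluthge_solution_def aluthge_field_def)
  have "continuous_on {0..\<tau>} X"
  proof (rule continuous_on_subset)
    show "continuous_on {0..} X" unfolding continuous_on_eq_continuous_within
      using der has_vector_derivative_continuous by blast
  qed auto
  then have "compact (X ` {0..\<tau>})" by (intro compact_continuous_image compact_Icc)
  moreover have "left_invertible A" if "A \<in> X ` {0..\<tau>}" for A using that inv by auto
  ultimately obtain m M where bd: "modulus_bounds m M" "X ` {0..\<tau>} \<subseteq> bounded_between m M"
    using compact_left_invertible_bounded_between by blast
  interpret modulus_bounds m M by fact
  interpret closed_one_step_scheme "bounded_between m M :: ('a \<Rightarrow>\<^sub>L 'a) set" aluthge_field aluthge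
    lipschitz_constant "2 * \<Lambda> * M" consistency_constant by (rule aluthge_scheme)
  have "X t \<in> bounded_between m M \<and> (X has_vector_derivative aluthge_field (X t)) (at t within {0..})"
    if "0 \<le> t" "t \<le> \<tau>" for t using that der bd(2) by auto
  from scheme_converges_to_solution[OF this] show ?thesis unfolding X0 by (rule that)
qed

text \<open>Any two solutions are limits of the same iterates, so they agree.\<close>
lemma aluthge_flow_eq:
  fixes T :: "'a::chilbert_space \<Rightarrow>\<^sub>L 'a"
  assumes X: "aluthge_solution T X" and t: "0 \<le> t"
  shows "aluthge_flow t T = X t"
  unfolding aluthge_flow_def
proof (rule the_equality)
  have lim: "(\<lambda>n. (aluthge (t / real n) ^^ n) T) \<longlonglongrightarrow> Y t" if Y: "aluthge_solution T Y" for Y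
  proof -
    obtain D where D: "\<And>n. t < real n \<Longrightarrow> norm ((aluthge (t / real n) ^^ n) T - Y t) \<le> D / real n"
      using aluthge_iterates_converge[OF Y t] t by (metis order_refl)
    have "\<forall>\<^sub>F n in sequentially. t < real n" using eventually_gt_at_top filterlim_real_sequentially
      by (metis filterlim_at_top_dense)
    then have "\<forall>\<^sub>F n in sequentially. norm ((aluthge (t / real n) ^^ n) T - Y t) \<le> D / real n"
      by eventually_elim (rule D)
    then have "(\<lambda>n. (aluthge (t / real n) ^^ n) T - Y t) \<longlonglongrightarrow> 0"
      by (rule Lim_null_comparison) (rule lim_const_over_n)
    then show ?thesis by (simp add: LIM_zero_iff)
  qed
  fix Z assume "\<exists>Y. aluthge_solution T Y \<and> Z = Y t"
  then show "Z = X t" using LIMSEQ_unique[OF lim lim[OF X]] by blast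
qed (use X in blast)

theorem propositionA1:
  fixes T :: "'a::chilbert_space \<Rightarrow>\<^sub>L 'a"
  assumes "left_invertible T"
  shows "\<forall>K::real set. compact K \<and> K \<subseteq> {0..} \<longrightarrow>
    uniform_limit K (\<lambda>n t. (aluthge (t / real n) ^^ n) T) (\<lambda>t. aluthge_flow t T) sequentially"
proof (intro allI impI, elim conjE)
  fix K :: "real set" assume K: "compact K" "K \<subseteq> {0..}"
  obtain X where X: "aluthge_solution T X" using aluthge_solution_exists[OF assms] .
  obtain b where b: "\<And>t. t \<in> K \<Longrightarrow> norm t \<le> b" using compact_imp_bounded[OF K(1)] by (auto simp: bounded_iff)
  define \<tau> where "\<tau> = max 0 b"
  have \<tau>: "0 \<le> \<tau>" "\<And>t. t \<in> K \<Longrightarrow> 0 \<le> t \<and> t \<le> \<tau>" using b K(2) by (force simp: \<tau>_def)+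
  obtain D where D: "\<And>n t. \<tau> < real n \<Longrightarrow> 0 \<le> t \<Longrightarrow> t \<le> \<tau> \<Longrightarrow>
      norm ((aluthge (t / real n) ^^ n) T - X t) \<le> D / real n"
    using aluthge_iterates_converge[OF X \<tau>(1)] by blast
  show "uniform_limit K (\<lambda>n t. (aluthge (t / real n) ^^ n) T) (\<lambda>t. aluthge_flow t T) sequentially"
  proof (rule uniform_limitI)
    fix e :: real assume e: "0 < e"
    have "\<forall>\<^sub>F n in sequentially. D / real n < e"
      using order_tendstoD(2)[OF lim_const_over_n[of D] e] .
    moreover have "\<forall>\<^sub>F n in sequentially. \<tau> < real n"
      using filterlim_real_sequentially by (simp add: filterlim_at_top_dense)
    ultimately show "\<forall>\<^sub>F n in sequentially. \<forall>t\<in>K. dist ((aluthge (t / real n) ^^ n) T) (aluthge_flow t T) < e"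
    proof eventually_elim
      case (elim n)
      show ?case
      proof
        fix t assume "t \<in> K"
        then have t: "0 \<le> t" "t \<le> \<tau>" using \<tau>(2) by auto
        show "dist ((aluthge (t / real n) ^^ n) T) (aluthge_flow t T) < e"
          using D[OF elim(2) t] elim(1) by (simp add: aluthge_flow_eq[OF X t(1)] dist_norm)
      qed
    qed
  qed
qed

end
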